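(* Let $K$ be a field, let $\mathscr{P}$ be a zigzag poset on the set $\{1,2,\ldots,n\}$, and let $M$ and $N$ be two pointwise finite-dimensional $\mathscr{P}$-persistence modules over $K$. Then $$R(M)=R(N)\quad\text{if and only if}\quad M\simeq N.$$
   Context: $K$ is an arbitrary field. For a poset $(\mathscr{P},\leq)$, a $\mathscr{P}$-persistence module $M$ is a functor from $\mathscr{P}$ (viewed as a category) to $K$-vector spaces: vector spaces $M_x$ ($x\in\mathscr{P}$) and linear maps $M_{yx}:M_x\to M_y$ for $x\leq y$, with $M_{zy}M_{yx}=M_{zx}$ for $x\le y\le z$ and $M_{xx}=\mathrm{id}$. It is pointwise finite-dimensional if every $M_x$ is finite-dimensional. Morphisms are natural transformations. A zigzag poset on $\{1,\ldots,n\}$ is a partial order $\leq_{\mathscr P}$ on $\{1,\ldots,n\}$ whose Hasse quiver is a Dynkin quiver of type $\mathbb{A}_n$ with arbitrary orientation, with vertices labelled consecutively $1,\ldots,n$: for each $k<n$ there is exactly one arrow between $k$ and $k+1$ (in either direction, an arrow $x\to y$ meaning that $y$ covers $x$), and there are no other arrows. For natural numbers $1\leq i\leq j\leq n$ (natural order of $\mathbb{N}$), let $S^+_{ij}$ be the set of minimal elements, and $S^-_{ij}$ the set of maximal elements, of the subposet $(\{i,i+1,\ldots,j\},\leq_{\mathscr P})$; put $\mathcal{S}_{ij}=(S^+_{ij},S^-_{ij})$. For $i<j$, the operator $\mathbf{T}_{M,\mathcal{S}_{ij}}$ is the nilpotent operator on $\bigoplus_{x\in S^+_{ij}}M_x\oplus\bigoplus_{y\in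 S^-_{ij}}M_y$ which vanishes on the second summand and restricts to the linear map $\bigoplus_{x\in S^+_{ij}}M_x\to\bigoplus_{y\in S^-_{ij}}M_y$ whose $(y,x)$-entry is $M_{yx}$ if $x<_{\mathscr P}y$ and $0$ otherwise. For $i=j$, $\mathbf{T}_{M,\mathcal{S}_{ii}}$ is understood to be $\mathrm{id}_{M_i}$. Define $$R(M):=\big(\operatorname{rank}(\mathbf{T}_{M,\mathcal{S}_{ij}})\big)_{1\leq i\leq j\leq n}\in\mathbb{N}^{\binom{n+1}{2}}.$$ *)

theory Defs
  imports Complex_Main "HOL-Library.Function_Algebras" "HOL-Library.Product_Plus" "HOL-Library.FuncSet"
begin

section \<open>Zigzag posets\<close>

text \<open>A poset is a carrier \<open>P\<close> with a relation \<open>r\<close> such that \<^term>\<open>partial_order_on P r\<close>;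
  \<^term>\<open>(x, y) \<in> r\<close> means that \<open>x\<close> is below or equal to \<open>y\<close>.\<close>

definition hasse_arrow :: "'p rel \<Rightarrow> 'p \<Rightarrow> 'p \<Rightarrow> bool" where
  "hasse_arrow r x y \<longleftrightarrow>
     (x, y) \<in> r \<and> x \<noteq> y \<and> (\<forall>z. (x, z) \<in> r \<and> (z, y) \<in> r \<longrightarrow> z = x \<or> z = y)"

definition zigzag_poset :: "nat \<Rightarrow> nat rel \<Rightarrow> bool" where
  "zigzag_poset n r \<longleftrightarrow>
     partial_order_on {1..n} r \<and>
     (\<forall>k. 1 \<le> k \<and> k < n \<longrightarrow>
        (hasse_arrow r k (k + 1) \<and> \<not> hasse_arrow r (k + 1) k) \<or>
        (hasse_arrow r (k + 1) k \<and> \<not> hasse_arrow r k (k + 1))) \<and>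
     (\<forall>x y. hasse_arrow r x y \<longrightarrow> y = x + 1 \<or> x = y + 1)"

definition minimal_elements :: "'p rel \<Rightarrow> 'p set \<Rightarrow> 'p set" where
  "minimal_elements r A = {x \<in> A. \<forall>z\<in>A. (z, x) \<in> r \<longrightarrow> z = x}"

definition maximal_elements :: "'p rel \<Rightarrow> 'p set \<Rightarrow> 'p set" where
  "maximal_elements r A = {x \<in> A. \<forall>z\<in>A. (x, z) \<in> r \<longrightarrow> z = x}"

section \<open>Persistence modules\<close>

definition linear_map_on ::
    "('k::field \<Rightarrow> 'v::ab_group_add \<Rightarrow> 'v) \<Rightarrow> ('k \<Rightarrow> 'w::ab_group_add \<Rightarrow> 'w) \<Rightarrow>
     'v set \<Rightarrow> 'w set \<Rightarrow> ('v \<Rightarrow> 'w) \<Rightarrow> bool" where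
  "linear_map_on s t V W f \<longleftrightarrow>
     f \<in> V \<rightarrow> W \<and>
     (\<forall>u\<in>V. \<forall>v\<in>V. f (u + v) = f u + f v) \<and>
     (\<forall>c. \<forall>v\<in>V. f (s c v) = t c (f v))"

text \<open>The vector spaces of a persistence module are subspaces of some common ambient \<open>'k\<close>-vector
  space \<open>'v\<close> with scalar multiplication \<open>scal\<close>.  This is no restriction, since any family of vector
  spaces embeds into its direct sum.  The positions of the subspaces relative to each other (they
  may even coincide) play no role, and neither do the values of the maps outside of them.
  The linear map from \<open>space_at M x\<close> to \<open>space_at M y\<close> is \<open>map_at M y x\<close>.\<close>

record ('p, 'k, 'v) pmodule =
  scal :: "'k \<Rightarrow> 'v \<Rightarrow> 'v"
  space_at :: "'p \<Rightarrow> 'v set"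
  map_at :: "'p \<Rightarrow> 'p \<Rightarrow> 'v \<Rightarrow> 'v"

definition persistence_module ::
    "'p set \<Rightarrow> 'p rel \<Rightarrow> ('p, 'k::field, 'v::ab_group_add) pmodule \<Rightarrow> bool" where
  "persistence_module P r M \<longleftrightarrow>
     partial_order_on P r \<and>
     vector_space (scal M) \<and>
     (\<forall>x\<in>P. module.subspace (scal M) (space_at M x)) \<and>
     (\<forall>x y. (x, y) \<in> r \<longrightarrow>
        linear_map_on (scal M) (scal M) (space_at M x) (space_at M y) (map_at M y x)) \<and>
     (\<forall>x\<in>P. \<forall>v\<in>space_at M x. map_at M x x v = v) \<and>
     (\<forall>x y z. (x, y) \<in> r \<and> (y, z) \<in> r \<longrightarrow>
        (\<forall>v\<in>space_at M x. map_at M z y (map_at M y x v) = map_at M z x v))"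

definition pointwise_finite_dimensional ::
    "'p set \<Rightarrow> ('p, 'k::field, 'v::ab_group_add) pmodule \<Rightarrow> bool" where
  "pointwise_finite_dimensional P M \<longleftrightarrow>
     (\<forall>x\<in>P. \<exists>B. finite B \<and> module.span (scal M) B = space_at M x)"

definition pmodule_morphism ::
    "'p set \<Rightarrow> 'p rel \<Rightarrow> ('p, 'k::field, 'v::ab_group_add) pmodule \<Rightarrow>
     ('p, 'k, 'w::ab_group_add) pmodule \<Rightarrow> ('p \<Rightarrow> 'v \<Rightarrow> 'w) \<Rightarrow> bool" where
  "pmodule_morphism P r M N \<phi> \<longleftrightarrow>
     (\<forall>x\<in>P. linear_map_on (scal M) (scal N) (space_at M x) (space_at N x) (\<phi> x)) \<and>
     (\<forall>x y. (x, y) \<in> r \<longrightarrow>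
        (\<forall>v\<in>space_at M x. \<phi> y (map_at M y x v) = map_at N y x (\<phi> x v)))"

definition pmodule_isomorphic ::
    "'p set \<Rightarrow> 'p rel \<Rightarrow> ('p, 'k::field, 'v::ab_group_add) pmodule \<Rightarrow>
     ('p, 'k, 'w::ab_group_add) pmodule \<Rightarrow> bool" where
  "pmodule_isomorphic P r M N \<longleftrightarrow>
     (\<exists>\<phi> \<psi>. pmodule_morphism P r M N \<phi> \<and> pmodule_morphism P r N M \<psi> \<and>
        (\<forall>x\<in>P. (\<forall>v\<in>space_at M x. \<psi> x (\<phi> x v) = v) \<and> (\<forall>w\<in>space_at N x. \<phi> x (\<psi> x w) = w)))"

section \<open>The operators and their ranks\<close>

text \<open>The external direct sum over a finite index set \<open>A\<close>, as families vanishing outside \<open>A\<close>.\<close>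

definition direct_sum :: "'p set \<Rightarrow> ('p \<Rightarrow> 'v::ab_group_add set) \<Rightarrow> ('p \<Rightarrow> 'v) set" where
  "direct_sum A V = {u. (\<forall>x\<in>A. u x \<in> V x) \<and> (\<forall>x. x \<notin> A \<longrightarrow> u x = 0)}"

definition pair_scal ::
    "('k \<Rightarrow> 'v \<Rightarrow> 'v) \<Rightarrow> 'k \<Rightarrow> ('p \<Rightarrow> 'v) \<times> ('p \<Rightarrow> 'v) \<Rightarrow> ('p \<Rightarrow> 'v) \<times> ('p \<Rightarrow> 'v)" where
  "pair_scal s c uv = ((\<lambda>x. s c (fst uv x)), (\<lambda>y. s c (snd uv y)))"

definition T_space ::
    "('p, 'k, 'v::ab_group_add) pmodule \<Rightarrow> 'p set \<times> 'p set \<Rightarrow> (('p \<Rightarrow> 'v) \<times> ('p \<Rightarrow> 'v)) set" where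
  "T_space M S = direct_sum (fst S) (space_at M) \<times> direct_sum (snd S) (space_at M)"

definition T_op ::
    "'p rel \<Rightarrow> ('p, 'k, 'v::ab_group_add) pmodule \<Rightarrow> 'p set \<times> 'p set \<Rightarrow>
     ('p \<Rightarrow> 'v) \<times> ('p \<Rightarrow> 'v) \<Rightarrow> ('p \<Rightarrow> 'v) \<times> ('p \<Rightarrow> 'v)" where
  "T_op r M S uv =
     ((\<lambda>x. 0),
      (\<lambda>y. if y \<in> snd S
           then \<Sum>x\<in>fst S. if (x, y) \<in> r \<and> x \<noteq> y then map_at M y x (fst uv x) else 0
           else 0))"

definition rank_on :: "('k::field \<Rightarrow> 'w::ab_group_add \<Rightarrow> 'w) \<Rightarrow> 'v set \<Rightarrow> ('v \<Rightarrow> 'w) \<Rightarrow> nat" where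
  "rank_on t V f = vector_space.dim t (f ` V)"

definition S_pair :: "nat rel \<Rightarrow> nat \<Rightarrow> nat \<Rightarrow> nat set \<times> nat set" where
  "S_pair r i j = (minimal_elements r {i..j}, maximal_elements r {i..j})"

definition R_invariant ::
    "nat \<Rightarrow> nat rel \<Rightarrow> (nat, 'k::field, 'v::ab_group_add) pmodule \<Rightarrow> nat \<times> nat \<Rightarrow> nat" where
  "R_invariant n r M =
     (\<lambda>(i, j)\<in>{(i, j). 1 \<le> i \<and> i \<le> j \<and> j \<le> n}.
        if i = j then rank_on (scal M) (space_at M i) (\<lambda>v. v)
        else rank_on (pair_scal (scal M)) (T_space M (S_pair r i j)) (T_op r M (S_pair r i j)))"

text \<open>The ambient space of \<open>T_space\<close> is a vector space, so that \<open>rank_on\<close> is meaningful, and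
  \<open>T_op\<close> is a nilpotent endomorphism of \<open>T_space\<close>.\<close>

lemma vector_space_pair_scal:
  assumes "vector_space s"
  shows "vector_space (pair_scal s)"
proof -
  interpret vector_space s by fact
  show ?thesis
    by unfold_locales
      (auto simp: pair_scal_def prod_eq_iff fun_eq_iff scale_right_distrib scale_left_distrib)
qed

lemma T_op_in_T_space:
  assumes M: "persistence_module P r M" and "fst S \<subseteq> P" "snd S \<subseteq> P" and uv: "uv \<in> T_space M S"
  shows "T_op r M S uv \<in> T_space M S"
proof -
  interpret vector_space "scal M" using M by (simp add: persistence_module_def)
  have sub: "subspace (space_at M x)" if "x \<in> P" for x
    using M that by (auto simp: persistence_module_def)
  have u: "fst uv x \<in> space_at M x" if "x \<in> fst S" for x
    using uv that by (auto simp: T_space_def direct_sum_def)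
  have m: "map_at M y x v \<in> space_at M y" if "(x, y) \<in> r" "v \<in> space_at M x" for x y v
    using M that unfolding persistence_module_def linear_map_on_def by blast
  have "(\<Sum>x\<in>fst S. if (x, y) \<in> r \<and> x \<noteq> y then map_at M y x (fst uv x) else 0) \<in> space_at M y"
    if "y \<in> snd S" for y
    using that assms(3) by (intro subspace_sum sub) (auto intro!: m u intro: subspace_0 sub)
  moreover have "0 \<in> space_at M x" if "x \<in> fst S" for x
    using that assms(2) by (auto intro!: subspace_0 sub)
  ultimately show ?thesis
    by (auto simp: T_op_def T_space_def direct_sum_def)
qed

lemma T_op_nilpotent:
  assumes M: "persistence_module P r M" and "fst S \<subseteq> P"
  shows "T_op r M S (T_op r M S uv) = 0"
proof -
  interpret vector_space "scal M" using M by (simp add: persistence_module_def)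
  have sub: "subspace (space_at M x)" if "x \<in> P" for x
    using M that by (auto simp: persistence_module_def)
  have "map_at M y x 0 = 0" if "(x, y) \<in> r" "x \<in> fst S" for x y
  proof -
    have "linear_map_on (scal M) (scal M) (space_at M x) (space_at M y) (map_at M y x)"
      using M that by (auto simp: persistence_module_def)
    moreover have "0 \<in> space_at M x"
      using that assms(2) by (auto intro!: subspace_0 sub)
    ultimately have "map_at M y x (0 + 0) = map_at M y x 0 + map_at M y x 0"
      unfolding linear_map_on_def by blast
    then show ?thesis by simp
  qed
  then show ?thesis
    by (auto simp: T_op_def prod_eq_iff fun_eq_iff intro!: sum.neutral)
qed

end

(* The members of the flag of subspaces of M_k obtained by transporting 0 and M_a (a <= k) from a
   to k, by images along forward arrows and preimages along backward arrows, have names that make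
   sense for N as well.  If corresponding members have equal dimensions, an isomorphism M_k -> N_k
   compatible with the flags extends step by step to an isomorphism of modules; linear relations
   that are bijective on their domain, enlarged by one pair of vectors at a time, avoid any
   choice of bases adapted to the flags, so the interval decomposition is not needed.
   The kernel of the map from the sources to the sinks of {i..j} projects onto a transported
   subspace of M_j, and the kernel of this projection is the one for a smaller set of sources and
   sinks; hence the ranks determine the dimensions of the flag. *)
theory Submission
  imports Defs
begin

section \<open>Finite-dimensional subspaces\<close>

text \<open>An arbitrary isomorphism at one vertex need not extend to the next: it may fail to match
  kernels, images, or the finer subspaces forced by vertices farther away. Working from right to
  left makes the flags the right control. The flag at k involves only vertices a <= k, and its
  members reappear at k + 1 as images or preimages, so an isomorphism that preserves the flag at k +
  1 already respects everything needed at k. Along a backward arrow k + 1 -> k the kernel is the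
  preimage of 0, which is why 0 must start a member of the flag. Along a forward arrow k -> k + 1
  the partner of a vector is prescribed only modulo a kernel; the choice can be made inside every
  flag member because rank-nullity makes the kernels of corresponding members equally large. Of the
  two start values 0 and M_a only one is new at each a < k, depending on the arrow between a and a +
  1; the other one gives the same subspace as a start at a + 1. The new one is the one that kernels
  of sources-to-sinks maps can see.\<close>

definition fd_subspace :: "('k::field \<Rightarrow> 'v::ab_group_add \<Rightarrow> 'v) \<Rightarrow> 'v set \<Rightarrow> bool" where
  "fd_subspace s V \<longleftrightarrow> module.subspace s V \<and> (\<exists>B. finite B \<and> module.span s B = V)"

lemma (in vector_space) fd_subspaceD: "fd_subspace scale V \<Longrightarrow> subspace V"
  by (simp add: fd_subspace_def)

text \<open>The ambient space may be infinite-dimensional; finiteness of the basis comes from the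
  exchange bound by a finite spanning set of \<open>V\<close>.\<close>

lemma (in vector_space) fd_subspace_basis:
  assumes V: "fd_subspace scale V" and U: "subspace U" "U \<subseteq> V" and S: "S \<subseteq> U" "independent S"
  obtains B where "S \<subseteq> B" "B \<subseteq> U" "independent B" "span B = U" "finite B" "card B = dim U"
proof -
  obtain B where B: "S \<subseteq> B" "B \<subseteq> U" "independent B" "U \<subseteq> span B"
    using maximal_independent_subset_extend S by blast
  obtain T where T: "finite T" "span T = V"
    using V by (auto simp: fd_subspace_def)
  have "finite B"
    using independent_span_bound[OF T(1) B(3)] B(2) U(2) T(2) by auto
  moreover have "span B = U"
    using B U by (intro span_subspace) auto
  moreover have "card B = dim U"
    using B by (intro basis_card_eq_dim) auto
  ultimately show thesis
    using that B by blast
qed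

lemma (in vector_space) fd_subspace_mono:
  assumes "fd_subspace scale V" "subspace U" "U \<subseteq> V"
  shows "fd_subspace scale U"
proof -
  obtain B where "span B = U" "finite B"
    using fd_subspace_basis[OF assms, of "{}"] by (metis empty_subsetI independent_empty)
  then show ?thesis
    using assms by (auto simp: fd_subspace_def)
qed

lemma (in vector_space) dim_fd_subspace:
  assumes "fd_subspace scale V" "subspace U" "U \<subseteq> V"
  shows "dim U \<le> dim V" and "dim U = dim V \<Longrightarrow> U = V"
proof -
  obtain B where B: "B \<subseteq> U" "independent B" "span B = U" "finite B" "card B = dim U"
    using fd_subspace_basis[OF assms, of "{}"] by (metis empty_subsetI independent_empty)
  obtain C where C: "B \<subseteq> C" "C \<subseteq> V" "independent C" "span C = V" "finite C" "card C = dim V"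
    using fd_subspace_basis[OF assms(1) fd_subspaceD[OF assms(1)] subset_refl, of B] B assms(3)
    by (metis subset_trans)
  show "dim U \<le> dim V"
    using B C by (metis card_mono)
  show "U = V" if "dim U = dim V"
    using B C that by (metis card_subset_eq)
qed

section \<open>Maps that are linear on a subspace only, and rank-nullity for them\<close>

lemma linear_map_on_add: "linear_map_on s t V W f \<Longrightarrow> u \<in> V \<Longrightarrow> v \<in> V \<Longrightarrow> f (u + v) = f u + f v"
  by (simp add: linear_map_on_def)

lemma linear_map_on_scale: "linear_map_on s t V W f \<Longrightarrow> v \<in> V \<Longrightarrow> f (s c v) = t c (f v)"
  by (simp add: linear_map_on_def)

lemma linear_map_on_mem: "linear_map_on s t V W f \<Longrightarrow> v \<in> V \<Longrightarrow> f v \<in> W"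
  by (auto simp: linear_map_on_def)

lemma linear_map_on_subset:
  "linear_map_on s t V W f \<Longrightarrow> U \<subseteq> V \<Longrightarrow> f ` U \<subseteq> X \<Longrightarrow> linear_map_on s t U X f"
  unfolding linear_map_on_def by blast

lemma linear_map_on_0: "linear_map_on s t V W f \<Longrightarrow> 0 \<in> V \<Longrightarrow> f 0 = 0"
  using linear_map_on_add[of s t V W f 0 0] by simp

lemma linear_map_on_sum:
  assumes f: "linear_map_on s t V W f" and V: "module.subspace s V" and s: "vector_space s"
    and g: "\<And>x. x \<in> A \<Longrightarrow> g x \<in> V"
  shows "f (sum g A) = (\<Sum>x\<in>A. f (g x))"
proof -
  interpret vector_space s by fact
  have z: "f 0 = 0"
    using linear_map_on_0[OF f] subspace_0[OF V] .
  show ?thesis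
    using g
  proof (induction A rule: infinite_finite_induct)
    case (insert x A)
    then have "sum g A \<in> V" "g x \<in> V"
      using subspace_sum[OF V, of A g] by auto
    then show ?case
      using insert linear_map_on_add[OF f, of "g x" "sum g A"] by simp
  qed (use z in auto)
qed

context vector_space_pair
begin

lemma subspace_image_on:
  assumes f: "linear_map_on s1 s2 V W f" and V: "vs1.subspace V"
  shows "vs2.subspace (f ` V)"
proof (rule vs2.subspaceI)
  show "0 \<in> f ` V"
    using linear_map_on_0[OF f] vs1.subspace_0[OF V] by (metis imageI)
  show "x + y \<in> f ` V" if "x \<in> f ` V" "y \<in> f ` V" for x y
    using that by (auto simp: linear_map_on_add[OF f, symmetric] intro: vs1.subspace_add[OF V])
  show "s2 c x \<in> f ` V" if "x \<in> f ` V" for c x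
    using that by (auto simp: linear_map_on_scale[OF f, symmetric] intro: vs1.subspace_scale[OF V])
qed

lemma subspace_preimage_on:
  assumes f: "linear_map_on s1 s2 V W f" and V: "vs1.subspace V" and X: "vs2.subspace X"
  shows "vs1.subspace {v \<in> V. f v \<in> X}"
  using vs1.subspace_0[OF V] vs2.subspace_0[OF X]
  by (intro vs1.subspaceI)
    (auto simp: linear_map_on_0[OF f] linear_map_on_add[OF f] linear_map_on_scale[OF f]
      intro: vs1.subspace_add[OF V] vs1.subspace_scale[OF V]
        vs2.subspace_add[OF X] vs2.subspace_scale[OF X])

lemma subspace_kernel_on:
  assumes "linear_map_on s1 s2 V W f" and "vs1.subspace V"
  shows "vs1.subspace {v \<in> V. f v = 0}"
  using subspace_preimage_on[OF assms, of "{0}"] by simp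

text \<open>\<open>f\<close> is controlled only on \<open>V\<close>, so a globally linear
  \<open>g\<close> that agrees with it there takes its place. A basis of the kernel is extended to
  one of \<open>V\<close>, and the added vectors \<open>C\<close> go to a basis of the
  image.\<close>

lemma rank_nullity:
  assumes f: "linear_map_on s1 s2 V W f" and V: "fd_subspace s1 V"
  shows "fd_subspace s2 (f ` V)"
    and "vs1.dim V = vs2.dim (f ` V) + vs1.dim {v \<in> V. f v = 0}"
proof -
  define K where "K = {v \<in> V. f v = 0}"
  note sV = vs1.fd_subspaceD[OF V]
  have sK: "vs1.subspace K" "K \<subseteq> V"
    using subspace_kernel_on[OF f sV] by (auto simp: K_def)
  obtain A where A: "A \<subseteq> K" "vs1.independent A" "vs1.span A = K" "card A = vs1.dim K"
    using vs1.fd_subspace_basis[OF V sK, of "{}"] by (metis empty_subsetI vs1.independent_empty)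
  obtain B where B: "A \<subseteq> B" "B \<subseteq> V" "vs1.independent B" "vs1.span B = V" "finite B"
    "card B = vs1.dim V"
    using vs1.fd_subspace_basis[OF V sV subset_refl, of A] A sK by (metis subset_trans)
  define C where "C = B - A"
  obtain g where g: "Vector_Spaces.linear s1 s2 g" "\<And>b. b \<in> B \<Longrightarrow> g b = f b"
    using linear_independent_extend[OF B(3), of f] by blast
  have gf: "g v = f v" if "v \<in> V" for v
  proof -
    have "v \<in> vs1.span B" using that B by simp
    moreover have "vs1.subspace {v \<in> V. g v = f v}"
      using vs1.subspace_0[OF sV]
      by (intro vs1.subspaceI)
        (auto simp: linear_map_on_0[OF f] linear_map_on_add[OF f] linear_map_on_scale[OF f]
          linear_0[OF g(1)] linear_add[OF g(1)] linear_scale[OF g(1)]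
          intro: vs1.subspace_add[OF sV] vs1.subspace_scale[OF sV])
    ultimately show ?thesis
      using vs1.span_minimal[of B "{v \<in> V. g v = f v}"] B(2) g(2) by blast
  qed
  have C: "C \<subseteq> V" "vs1.independent C" "finite C"
    using B vs1.independent_mono by (auto simp: C_def)
  have spanC: "vs1.span C \<subseteq> V"
    using C sV by (simp add: vs1.span_minimal)
  have inj: "inj_on g (vs1.span C)"
  proof (subst linear_inj_on_iff_eq_0[OF g(1)], safe)
    fix x assume x: "x \<in> vs1.span C" "g x = 0"
    interpret e: vector_space_pair s1 s1 ..
    \<comment> \<open>The projection of \<open>V\<close> onto the span of \<open>C\<close> along the
      kernel. An \<open>x\<close> in the span of \<open>C\<close> with \<open>g x = 0\<close> lies
      in both spans, so it is both fixed and killed.\<close>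
    obtain h where h: "Vector_Spaces.linear s1 s1 h" "\<And>b. b \<in> B \<Longrightarrow> h b = (if b \<in> C then b else 0)"
      using e.linear_independent_extend[OF B(3), of "\<lambda>b. if b \<in> C then b else 0"] by blast
    have "x \<in> vs1.span A"
      using x spanC gf A(3) by (auto simp: K_def)
    then have "h x = 0"
      by (rule e.linear_eq_0_on_span[OF h(1), rotated]) (use h B in \<open>auto simp: C_def\<close>)
    moreover have "h x = x"
      by (rule e.linear_eq_on[OF h(1) _ x(1)])
        (use h in \<open>auto simp: C_def vs1.linear_ident\<close>)
    ultimately show "x = 0" by simp
  qed
  have im: "f ` V = vs2.span (g ` C)"
  proof -
    have "f ` V = g ` vs1.span B"
      using gf B(4) by (simp add: image_def)
    also have "\<dots> = vs2.span (g ` B)"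
      by (simp add: linear_span_image[OF g(1)])
    also have "\<dots> = vs2.span (g ` C)"
    proof -
      have "g ` A \<subseteq> {0}"
        using A(1) gf by (auto simp: K_def)
      then have "g ` B \<subseteq> insert 0 (g ` C)"
        using B(1) by (auto simp: C_def)
      moreover have "g ` C \<subseteq> g ` B" by (auto simp: C_def)
      ultimately show ?thesis
        by (metis vs2.span_insert_0 vs2.span_mono subset_antisym)
    qed
    finally show ?thesis .
  qed
  show "fd_subspace s2 (f ` V)"
    unfolding fd_subspace_def im using C(3) by auto
  have "vs2.dim (f ` V) = card (g ` C)"
    unfolding im using linear_independent_injective_image[OF g(1) C(2) inj]
    by (simp add: vs2.dim_eq_card_independent)
  also have "\<dots> = card C"
    using inj vs1.span_superset by (intro card_image) (metis inj_on_subset)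
  also have "\<dots> = vs1.dim V - vs1.dim K"
    unfolding C_def using B A by (metis card_Diff_subset finite_subset)
  moreover have "vs1.dim K \<le> vs1.dim V"
    using A B by (metis card_mono)
  ultimately show "vs1.dim V = vs2.dim (f ` V) + vs1.dim {v \<in> V. f v = 0}"
    by (simp add: K_def)
qed

lemma dim_image_inj_on:
  assumes f: "linear_map_on s1 s2 V W f" and V: "fd_subspace s1 V"
    and inj: "\<And>v. v \<in> V \<Longrightarrow> f v = 0 \<Longrightarrow> v = 0"
  shows "vs2.dim (f ` V) = vs1.dim V"
proof -
  have "{v \<in> V. f v = 0} = {0}"
    using inj linear_map_on_0[OF f] vs1.subspace_0[OF vs1.fd_subspaceD[OF V]] by auto
  moreover have "vs1.dim {0} = 0"
    using vs1.dim_le_card[of "{0}" "{}"] by simp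
  ultimately show ?thesis
    using rank_nullity(2)[OF f V] by simp
qed

end

section \<open>External direct sums of finite-dimensional subspaces\<close>

definition fun_scale :: "('k \<Rightarrow> 'v \<Rightarrow> 'v) \<Rightarrow> 'k \<Rightarrow> ('p \<Rightarrow> 'v) \<Rightarrow> 'p \<Rightarrow> 'v" where
  "fun_scale s c u = (\<lambda>x. s c (u x))"

lemma fun_scale_apply: "fun_scale s c u x = s c (u x)"
  by (simp add: fun_scale_def)

lemma vector_space_fun_scale: "vector_space s \<Longrightarrow> vector_space (fun_scale s)"
proof -
  assume "vector_space s"
  then interpret vector_space s .
  show ?thesis
    by unfold_locales (auto simp: fun_scale_def fun_eq_iff scale_right_distrib scale_left_distrib)
qed

lemma direct_sumD: "u \<in> direct_sum A V \<Longrightarrow> x \<in> A \<Longrightarrow> u x \<in> V x" "u \<in> direct_sum A V \<Longrightarrow> x \<notin> A \<Longrightarrow> u x = 0"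
  by (auto simp: direct_sum_def)

lemma direct_sum_insert_restrict:
  "u \<in> direct_sum (insert a A) V \<Longrightarrow> a \<notin> A \<Longrightarrow> u(a := 0) \<in> direct_sum A V"
  by (auto simp: direct_sum_def)

context vector_space
begin

lemma subspace_direct_sum:
  assumes "\<And>x. x \<in> A \<Longrightarrow> subspace (V x)"
  shows "module.subspace (fun_scale scale) (direct_sum A V)"
proof -
  interpret f: vector_space "fun_scale scale"
    by (rule vector_space_fun_scale) (rule vector_space_axioms)
  show ?thesis
    using assms
    by (intro f.subspaceI) (auto simp: fun_scale_apply direct_sum_def subspace_0 subspace_add subspace_scale)
qed

lemma fd_direct_sum:
  assumes "finite A" "\<And>x. x \<in> A \<Longrightarrow> fd_subspace scale (V x)"
  shows "fd_subspace (fun_scale scale) (direct_sum A V)"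
  using assms
proof (induction A rule: finite_induct)
  case empty
  interpret f: vector_space "fun_scale scale"
    by (rule vector_space_fun_scale) (rule vector_space_axioms)
  have "direct_sum {} V = {0}" by (auto simp: direct_sum_def fun_eq_iff)
  moreover have "f.span {} = {0}" by simp
  ultimately show ?case
    unfolding fd_subspace_def using f.subspace_0 by (metis finite.emptyI f.subspace_span)
next
  case (insert a A)
  interpret f: vector_space "fun_scale scale"
    by (rule vector_space_fun_scale) (rule vector_space_axioms)
  interpret p: vector_space_pair scale "fun_scale scale" ..
  have sub: "f.subspace (direct_sum (insert a A) V)"
    using insert.prems fd_subspaceD by (intro subspace_direct_sum) blast
  obtain C where C: "finite C" "f.span C = direct_sum A V"
    using insert.IH[OF insert.prems] unfolding fd_subspace_def by blast
  obtain B where B: "finite B" "span B = V a"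
    using insert.prems by (auto simp: fd_subspace_def)
  \<comment> \<open>The embedding as coordinate \<open>a\<close>; every family \<open>u\<close> is
    \<open>e (u a)\<close> plus a family that vanishes at \<open>a\<close>.\<close>
  define e where "e v = (0 :: 'c \<Rightarrow> 'b)(a := v)" for v
  have e: "Vector_Spaces.linear scale (fun_scale scale) e"
    by unfold_locales (auto simp: fun_scale_apply e_def fun_eq_iff)
  have sA: "0 \<in> V x" if "x \<in> A" for x
    using insert.prems that fd_subspaceD subspace_0 by blast
  have "e v \<in> direct_sum (insert a A) V" if "v \<in> V a" for v
    using that sA by (auto simp: direct_sum_def e_def)
  moreover have "direct_sum A V \<subseteq> direct_sum (insert a A) V"
    using insert.prems[of a] fd_subspaceD subspace_0 by (auto simp: direct_sum_def)
  ultimately have "e ` B \<union> C \<subseteq> direct_sum (insert a A) V"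
    using B(2) C(2) span_superset[of B] f.span_superset[of C] by blast
  moreover have "direct_sum (insert a A) V \<subseteq> f.span (e ` B \<union> C)"
  proof
    fix u assume u: "u \<in> direct_sum (insert a A) V"
    have "e (u a) \<in> f.span (e ` B)"
      using direct_sumD(1)[OF u, of a] B(2) by (simp add: p.linear_span_image[OF e])
    moreover have "u(a := 0) \<in> f.span C"
      using direct_sum_insert_restrict[OF u insert.hyps(2)] C(2) by simp
    ultimately have "e (u a) + u(a := 0) \<in> f.span (e ` B \<union> C)"
      by (meson Un_upper1 Un_upper2 f.span_add f.span_mono subsetD)
    moreover have "e (u a) + u(a := 0) = u"
      by (auto simp: e_def fun_eq_iff)
    ultimately show "u \<in> f.span (e ` B \<union> C)" by simp
  qed
  ultimately have "f.span (e ` B \<union> C) = direct_sum (insert a A) V"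
    using sub f.span_subspace by blast
  then show ?case
    unfolding fd_subspace_def using sub B(1) C(1)
    by (intro conjI exI[of _ "e ` B \<union> C"]) auto
qed

text \<open>Evaluation at the adjoined index has image \<open>V a\<close>, and its kernel is the
  direct sum over the remaining indices, so rank-nullity adds one summand.\<close>

lemma dim_direct_sum:
  assumes "finite A" "\<And>x. x \<in> A \<Longrightarrow> fd_subspace scale (V x)"
  shows "vector_space.dim (fun_scale scale) (direct_sum A V) = (\<Sum>x\<in>A. dim (V x))"
  using assms
proof (induction A rule: finite_induct)
  case empty
  interpret f: vector_space "fun_scale scale"
    by (rule vector_space_fun_scale) (rule vector_space_axioms)
  have "direct_sum {} V = {0}" by (auto simp: direct_sum_def fun_eq_iff)
  then show ?case
    using f.dim_le_card[of "{0}" "{}"] by simp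
next
  case (insert a A)
  interpret f: vector_space "fun_scale scale"
    by (rule vector_space_fun_scale) (rule vector_space_axioms)
  interpret p: vector_space_pair "fun_scale scale" scale ..
  let ?D = "direct_sum (insert a A) V"
  have lin: "linear_map_on (fun_scale scale) scale ?D UNIV (\<lambda>u. u a)"
    by (auto simp: fun_scale_apply linear_map_on_def)
  have fd: "fd_subspace (fun_scale scale) ?D"
    using insert by (intro fd_direct_sum) auto
  have "0 \<in> V x" if "x \<in> insert a A" for x
    using insert.prems that fd_subspaceD subspace_0 by blast
  then have "(\<lambda>u. u a) ` ?D = V a"
    by (auto simp: direct_sum_def image_iff intro!: exI[of _ "0(a := _)"])
  moreover have "{u \<in> ?D. u a = 0} = direct_sum A V"
    using insert.hyps(2) \<open>\<And>x. x \<in> insert a A \<Longrightarrow> 0 \<in> V x\<close> unfolding direct_sum_def by (safe; (simp; fail)?) (metis insert_iff)+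
  ultimately show ?case
    using p.rank_nullity(2)[OF lin fd] insert by simp
qed

end

section \<open>Linear relations compatible with flags\<close>

text \<open>Subspaces of the product space. They need not be single-valued, so that the constraints
  imposed on an extension, up to the full product, are covered too.\<close>

definition linear_relation ::
    "('k \<Rightarrow> 'v::ab_group_add \<Rightarrow> 'v) \<Rightarrow> ('k \<Rightarrow> 'w::ab_group_add \<Rightarrow> 'w) \<Rightarrow> ('v \<times> 'w) set \<Rightarrow> bool" where
  "linear_relation s t G \<longleftrightarrow>
     (0, 0) \<in> G \<and>
     (\<forall>v w v' w'. (v, w) \<in> G \<longrightarrow> (v', w') \<in> G \<longrightarrow> (v + v', w + w') \<in> G) \<and>
     (\<forall>c v w. (v, w) \<in> G \<longrightarrow> (s c v, t c w) \<in> G)"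

text \<open>Subtracting two pairs with a common entry shows that the condition on zeros makes
  \<open>G\<close> the graph of an isomorphism from its domain onto its range. A graph carries no
  values outside its domain and treats both sides alike, so facts about ranges turn into facts about
  domains by passing to the converse.\<close>

definition partial_iso ::
    "('k \<Rightarrow> 'v::ab_group_add \<Rightarrow> 'v) \<Rightarrow> ('k \<Rightarrow> 'w::ab_group_add \<Rightarrow> 'w) \<Rightarrow> ('v \<times> 'w) set \<Rightarrow> bool" where
  "partial_iso s t G \<longleftrightarrow>
     linear_relation s t G \<and> (\<forall>v w. (v, w) \<in> G \<longrightarrow> (v = 0 \<longleftrightarrow> w = 0))"

text \<open>Only pairs in \<open>G\<close> are tested, so the zero relation is compatible with any
  flags of subspaces. Once a partial isomorphism has \<open>F i\<close> in its domain and
  \<open>H i\<close> in its range, it maps \<open>F i\<close> onto \<open>H i\<close>.\<close>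

definition compatible :: "('v \<times> 'w) set \<Rightarrow> 'i set \<Rightarrow> ('i \<Rightarrow> 'v set) \<Rightarrow> ('i \<Rightarrow> 'w set) \<Rightarrow> bool" where
  "compatible G I F H \<longleftrightarrow> (\<forall>i\<in>I. \<forall>v w. (v, w) \<in> G \<longrightarrow> (v \<in> F i \<longleftrightarrow> w \<in> H i))"

lemma linear_relation_converse: "linear_relation t s (G\<inverse>) \<longleftrightarrow> linear_relation s t G"
  by (auto simp: linear_relation_def)

lemma partial_iso_converse: "partial_iso t s (G\<inverse>) \<longleftrightarrow> partial_iso s t G"
  by (auto simp: partial_iso_def linear_relation_converse)

lemma compatibleD: "compatible G I F H \<Longrightarrow> i \<in> I \<Longrightarrow> (v, w) \<in> G \<Longrightarrow> v \<in> F i \<longleftrightarrow> w \<in> H i"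
  by (auto simp: compatible_def)

context vector_space_pair
begin

context
  fixes G
  assumes G: "partial_iso s1 s2 G"
begin

lemma partial_iso_0: "(0, 0) \<in> G"
  using G by (auto simp: partial_iso_def linear_relation_def)

lemma partial_iso_add: "(v, w) \<in> G \<Longrightarrow> (v', w') \<in> G \<Longrightarrow> (v + v', w + w') \<in> G"
  using G by (auto simp: partial_iso_def linear_relation_def)

lemma partial_iso_scale: "(v, w) \<in> G \<Longrightarrow> (s1 c v, s2 c w) \<in> G"
  using G by (auto simp: partial_iso_def linear_relation_def)

lemma partial_iso_diff: "(v, w) \<in> G \<Longrightarrow> (v', w') \<in> G \<Longrightarrow> (v - v', w - w') \<in> G"
  using partial_iso_add[of v w "- v'" "- w'"] partial_iso_scale[of v' w' "- 1"] by simp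

lemma partial_iso_0_iff: "(v, w) \<in> G \<Longrightarrow> v = 0 \<longleftrightarrow> w = 0"
  using G by (auto simp: partial_iso_def)

lemma partial_iso_unique: "(v, w) \<in> G \<Longrightarrow> (v, w') \<in> G \<Longrightarrow> w = w'"
  using partial_iso_diff[of v w v w'] partial_iso_0_iff[of 0 "w - w'"] by simp

lemma partial_iso_unique_left: "(v, w) \<in> G \<Longrightarrow> (v', w) \<in> G \<Longrightarrow> v = v'"
  using partial_iso_diff[of v w v' w] partial_iso_0_iff[of "v - v'" 0] by simp

lemma subspace_Domain: "vs1.subspace (Domain G)"
  by (intro vs1.subspaceI) (auto intro: partial_iso_0 partial_iso_add partial_iso_scale)

lemma subspace_Range: "vs2.subspace (Range G)"
  by (intro vs2.subspaceI) (auto intro: partial_iso_0 partial_iso_add partial_iso_scale)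

lemma partial_iso_function:
  "\<exists>f. linear_map_on s1 s2 (Domain G) (Range G) f \<and> (\<forall>v\<in>Domain G. (v, f v) \<in> G)"
proof -
  define f where "f v = (THE w. (v, w) \<in> G)" for v
  have f: "f v = w" if "(v, w) \<in> G" for v w
    unfolding f_def using that partial_iso_unique by blast
  then have f': "(v, f v) \<in> G" if "v \<in> Domain G" for v
    using that by auto
  have "linear_map_on s1 s2 (Domain G) (Range G) f"
    unfolding linear_map_on_def
    using f f' by (auto simp: f[OF partial_iso_add] f[OF partial_iso_scale])
  with f' show ?thesis by blast
qed

lemma partial_iso_Image:
  assumes U: "fd_subspace s1 U" "U \<subseteq> Domain G"
  shows "fd_subspace s2 (G `` U)" "vs2.dim (G `` U) = vs1.dim U"
proof -
  obtain f where f: "linear_map_on s1 s2 (Domain G) (Range G) f"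
    "\<And>v. v \<in> Domain G \<Longrightarrow> (v, f v) \<in> G"
    using partial_iso_function by blast
  have GU: "G `` U = f ` U"
  proof
    show "f ` U \<subseteq> G `` U"
      using f(2) U(2) by blast
    show "G `` U \<subseteq> f ` U"
      using f(2) partial_iso_unique by blast
  qed
  have fU: "linear_map_on s1 s2 U UNIV f"
    using linear_map_on_subset[OF f(1) U(2)] by simp
  show "fd_subspace s2 (G `` U)"
    unfolding GU by (rule rank_nullity[OF fU U(1)])
  have "v = 0" if "v \<in> U" "f v = 0" for v
    using f(2)[of v] U(2) that partial_iso_0_iff by auto
  then show "vs2.dim (G `` U) = vs1.dim U"
    unfolding GU by (rule dim_image_inj_on[OF fU U(1)])
qed

text \<open>A dimension count: \<open>G\<close> carries \<open>X\<close> injectively into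
  \<open>Y\<close>, and a subspace of full dimension is all of \<open>Y\<close>.\<close>

lemma Range_supset:
  assumes X: "fd_subspace s1 X" and Y: "fd_subspace s2 Y" and "vs1.dim X = vs2.dim Y"
    and "X \<subseteq> Domain G" "G `` X \<subseteq> Y"
  shows "Y \<subseteq> Range G"
proof -
  have "G `` X = Y"
    using partial_iso_Image[OF X] assms(3-5) vs2.dim_fd_subspace(2)[OF Y] vs2.fd_subspaceD by metis
  then show ?thesis by auto
qed

end

lemma Domain_supset:
  assumes G: "partial_iso s1 s2 G"
    and X: "fd_subspace s1 X" and Y: "fd_subspace s2 Y" and "vs1.dim X = vs2.dim Y"
    and "Y \<subseteq> Range G" "G\<inverse> `` Y \<subseteq> X"
  shows "X \<subseteq> Domain G"
proof -
  interpret c: vector_space_pair s2 s1 ..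
  show ?thesis
    using c.Range_supset[of "G\<inverse>", OF _ Y X] assms by (simp add: partial_iso_converse)
qed

text \<open>Dividing by a nonzero coefficient \<open>c\<close> would put \<open>v\<close> into the
  domain or \<open>w\<close> into the range. This yields the condition on zeros; the two facts on
  coefficients are also stated separately, because compatibility with flag members that are already
  matched rests on them.\<close>

lemma partial_iso_insert:
  assumes G: "partial_iso s1 s2 G" and v: "v \<notin> Domain G" and w: "w \<notin> Range G"
  shows "partial_iso s1 s2 {(x + s1 c v, y + s2 c w) | x y c. (x, y) \<in> G}" (is "partial_iso s1 s2 ?G")
    and "x + s1 c v \<in> Domain G \<Longrightarrow> x \<in> Domain G \<Longrightarrow> c = 0"
    and "y + s2 c w \<in> Range G \<Longrightarrow> y \<in> Range G \<Longrightarrow> c = 0"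
proof -
  have c1: "c = 0" if "x + s1 c v \<in> Domain G" "x \<in> Domain G" for c x
  proof (rule ccontr)
    assume "c \<noteq> 0"
    have "s1 c v \<in> Domain G"
      using vs1.subspace_diff[OF subspace_Domain[OF G] that] by simp
    then have "s1 (inverse c) (s1 c v) \<in> Domain G"
      by (rule vs1.subspace_scale[OF subspace_Domain[OF G]])
    then show False using \<open>c \<noteq> 0\<close> v by simp
  qed
  have c2: "c = 0" if "y + s2 c w \<in> Range G" "y \<in> Range G" for c y
  proof (rule ccontr)
    assume "c \<noteq> 0"
    have "s2 c w \<in> Range G"
      using vs2.subspace_diff[OF subspace_Range[OF G] that] by simp
    then have "s2 (inverse c) (s2 c w) \<in> Range G"
      by (rule vs2.subspace_scale[OF subspace_Range[OF G]])
    then show False using \<open>c \<noteq> 0\<close> w by simp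
  qed
  show "x + s1 c v \<in> Domain G \<Longrightarrow> x \<in> Domain G \<Longrightarrow> c = 0"
    "y + s2 c w \<in> Range G \<Longrightarrow> y \<in> Range G \<Longrightarrow> c = 0"
    using c1 c2 by auto
  have "(0, 0) \<in> ?G"
    using partial_iso_0[OF G] vs1.scale_zero_left vs2.scale_zero_left
    by (smt (verit) add.right_neutral mem_Collect_eq)
  moreover have "(a + a', b + b') \<in> ?G" if ab: "(a, b) \<in> ?G" "(a', b') \<in> ?G" for a b a' b'
  proof -
    obtain x y c where 1: "a = x + s1 c v" "b = y + s2 c w" "(x, y) \<in> G"
      using ab(1) by auto
    obtain x' y' c' where 2: "a' = x' + s1 c' v" "b' = y' + s2 c' w" "(x', y') \<in> G"
      using ab(2) by auto
    from 1 2 have "a + a' = (x + x') + s1 (c + c') v" "b + b' = (y + y') + s2 (c + c') w"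
      "(x + x', y + y') \<in> G"
      by (auto simp: vs1.scale_left_distrib vs2.scale_left_distrib partial_iso_add[OF G])
    then show ?thesis by blast
  qed
  moreover have "(s1 d a, s2 d b) \<in> ?G" if ab: "(a, b) \<in> ?G" for a b d
  proof -
    obtain x y c where "a = x + s1 c v" "b = y + s2 c w" "(x, y) \<in> G"
      using ab by auto
    then have "s1 d a = s1 d x + s1 (d * c) v" "s2 d b = s2 d y + s2 (d * c) w"
      "(s1 d x, s2 d y) \<in> G"
      by (auto simp: vs1.scale_right_distrib vs2.scale_right_distrib partial_iso_scale[OF G])
    then show ?thesis by blast
  qed
  moreover have "a = 0 \<longleftrightarrow> b = 0" if ab: "(a, b) \<in> ?G" for a b
  proof -
    obtain x y c where xy: "a = x + s1 c v" "b = y + s2 c w" "(x, y) \<in> G"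
      using ab by auto
    have "c = 0" if "a = 0"
      by (rule c1[of x]) (use xy that vs1.subspace_0[OF subspace_Domain[OF G]] in auto)
    moreover have "c = 0" if "b = 0"
      by (rule c2[of y]) (use xy that vs2.subspace_0[OF subspace_Range[OF G]] in auto)
    moreover have "a = 0 \<longleftrightarrow> b = 0" if "c = 0"
      using xy(1,2) that partial_iso_0_iff[OF G xy(3)] by simp
    ultimately show ?thesis by blast
  qed
  ultimately show "partial_iso s1 s2 ?G"
    unfolding partial_iso_def linear_relation_def by blast
qed

end

section \<open>Extension of partial isomorphisms between flags of equal dimensions\<close>

locale flag_pair = vector_space_pair s1 s2
  for s1 :: "'a::field \<Rightarrow> 'b::ab_group_add \<Rightarrow> 'b" and s2 :: "'a \<Rightarrow> 'c::ab_group_add \<Rightarrow> 'c" +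
  fixes V :: "'b set" and W :: "'c set" and I :: "'i set" and F :: "'i \<Rightarrow> 'b set"
    and H :: "'i \<Rightarrow> 'c set" and t :: 'i
  assumes V: "fd_subspace s1 V" and W: "fd_subspace s2 W"
    and F: "\<And>i. i \<in> I \<Longrightarrow> vs1.subspace (F i) \<and> F i \<subseteq> V"
    and H: "\<And>i. i \<in> I \<Longrightarrow> vs2.subspace (H i) \<and> H i \<subseteq> W"
    and dim: "\<And>i. i \<in> I \<Longrightarrow> vs1.dim (F i) = vs2.dim (H i)"
    and chain: "\<And>i j. i \<in> I \<Longrightarrow> j \<in> I \<Longrightarrow> F i \<subseteq> F j \<and> H i \<subseteq> H j \<or> F j \<subseteq> F i \<and> H j \<subseteq> H i"
    and top: "t \<in> I" "F t = V" "H t = W"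
begin

lemma fd_flag: "i \<in> I \<Longrightarrow> fd_subspace s1 (F i)" "i \<in> I \<Longrightarrow> fd_subspace s2 (H i)"
  using F H V W vs1.fd_subspace_mono vs2.fd_subspace_mono by blast+

text \<open>Adjoining a pair \<open>(v, w)\<close> from a member of the flags of least dimension among those not
  inside the domain preserves compatibility: every smaller member is in the domain already, and
  every larger one contains \<open>(v, w)\<close>. The relation \<open>C\<close> is an additional linear constraint.\<close>

lemma partial_iso_extend:
  assumes C: "linear_relation s1 s2 C"
    and step: "\<And>G i. partial_iso s1 s2 G \<Longrightarrow> G \<subseteq> C \<Longrightarrow> compatible G I F H \<Longrightarrow> i \<in> I \<Longrightarrow>
      \<not> F i \<subseteq> Domain G \<Longrightarrow> \<exists>v w. v \<in> F i \<and> v \<notin> Domain G \<and> w \<in> H i \<and> w \<notin> Range G \<and> (v, w) \<in> C"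
    and "partial_iso s1 s2 G" "G \<subseteq> V \<times> W" "G \<subseteq> C" "compatible G I F H"
  shows "\<exists>G'. G \<subseteq> G' \<and> partial_iso s1 s2 G' \<and> Domain G' = V \<and> Range G' = W \<and> G' \<subseteq> C \<and>
    compatible G' I F H"
  using assms(3-)
proof (induction "vs1.dim V - vs1.dim (Domain G)" arbitrary: G rule: less_induct)
  case less
  note G = less.prems(1) and GVW = less.prems(2) and GC = less.prems(3) and GR = less.prems(4)
  note fdF = fd_flag(1) and fdH = fd_flag(2)
  have RS: "H i \<subseteq> Range G" if "i \<in> I" "F i \<subseteq> Domain G" for i
    using that by (intro Range_supset[OF G fdF fdH dim]) (auto simp: compatibleD[OF GR])
  show ?case
  proof (cases "V \<subseteq> Domain G")
    case True
    then have "W \<subseteq> Range G" using RS[of t] top by simp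
    then show ?thesis
      using True G GC GR GVW by (intro exI[of _ G]) blast
  next
    case False
    obtain i where i: "i \<in> I" "\<not> F i \<subseteq> Domain G"
      "\<And>j. j \<in> I \<Longrightarrow> \<not> F j \<subseteq> Domain G \<Longrightarrow> vs1.dim (F i) \<le> vs1.dim (F j)"
      using False top ex_has_least_nat[of "\<lambda>i. i \<in> I \<and> \<not> F i \<subseteq> Domain G" t "\<lambda>i. vs1.dim (F i)"]
      by blast
    obtain v w where vw: "v \<in> F i" "v \<notin> Domain G" "w \<in> H i" "w \<notin> Range G" "(v, w) \<in> C"
      using step[OF G GC GR i(1,2)] by blast
    define G' where "G' = {(x + s1 c v, y + s2 c w) | x y c. (x, y) \<in> G}"
    note ins = partial_iso_insert[OF G vw(2,4)]
    have G': "partial_iso s1 s2 G'"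
      unfolding G'_def by (rule ins)
    have sub: "G \<subseteq> G'"
    proof
      fix p assume "p \<in> G"
      then have "(fst p + s1 0 v, snd p + s2 0 w) \<in> G'"
        unfolding G'_def by (metis (mono_tags, lifting) mem_Collect_eq prod.collapse)
      then show "p \<in> G'" by simp
    qed
    have vV: "v \<in> V" and wW: "w \<in> W"
      using vw F[OF i(1)] H[OF i(1)] by auto
    have "(v, w) \<in> G'"
      unfolding G'_def using partial_iso_0[OF G] vs1.scale_one vs2.scale_one
      by (smt (verit) add.left_neutral mem_Collect_eq)
    then have vD: "v \<in> Domain G'" by auto
    have G'VW: "G' \<subseteq> V \<times> W"
      unfolding G'_def using GVW vV wW vs1.fd_subspaceD[OF V] vs2.fd_subspaceD[OF W]
      by (auto intro!: vs1.subspace_add vs2.subspace_add vs1.subspace_scale vs2.subspace_scale)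
    have G'C: "G' \<subseteq> C"
      using C GC vw(5) unfolding G'_def linear_relation_def by blast
    have G'R: "compatible G' I F H"
      unfolding compatible_def
    proof (intro ballI allI impI)
      fix l a b assume l: "l \<in> I" and ab: "(a, b) \<in> G'"
      obtain x y c where xy: "a = x + s1 c v" "b = y + s2 c w" "(x, y) \<in> G"
        using ab by (auto simp: G'_def)
      show "a \<in> F l \<longleftrightarrow> b \<in> H l"
      proof (cases "F l \<subseteq> Domain G")
        case True
        \<comment> \<open>A pair of \<open>G'\<close> with one entry in a member that is already
          matched has coefficient 0, so it lies in \<open>G\<close> itself.\<close>
        then have "c = 0" if "a \<in> F l \<or> b \<in> H l"
          using that RS[OF l True] xy ins(2)[of x c] ins(3)[of y c] by blast
        moreover have "x \<in> F l \<longleftrightarrow> y \<in> H l"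
          using compatibleD[OF GR l xy(3)] .
        ultimately show ?thesis
          using xy by auto
      next
        case False
        \<comment> \<open>If the inclusions go the other way, the minimal dimension of
          \<open>F i\<close> turns them into equalities on both sides.\<close>
        have "F i \<subseteq> F l \<and> H i \<subseteq> H l"
          using chain[OF i(1) l]
        proof
          assume *: "F l \<subseteq> F i \<and> H l \<subseteq> H i"
          then have "F l = F i"
            using vs1.dim_fd_subspace[OF fdF[OF i(1)], of "F l"] F[OF l] i(3)[OF l False] by simp
          moreover have "H l = H i"
            using * vs2.dim_fd_subspace[OF fdH[OF i(1)], of "H l"] H[OF l] dim[OF l] dim[OF i(1)]
              \<open>F l = F i\<close> by simp
          ultimately show ?thesis by simp
        qed
        then have cv: "s1 c v \<in> F l" "s2 c w \<in> H l"
          using vw F[OF l] H[OF l] by (auto intro!: vs1.subspace_scale vs2.subspace_scale)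
        have "a \<in> F l \<longleftrightarrow> x \<in> F l"
          using cv(1) F[OF l] xy(1) vs1.subspace_add vs1.subspace_diff by (metis add_diff_cancel)
        moreover have "b \<in> H l \<longleftrightarrow> y \<in> H l"
          using cv(2) H[OF l] xy(2) vs2.subspace_add vs2.subspace_diff by (metis add_diff_cancel)
        ultimately show ?thesis
          using compatibleD[OF GR l xy(3)] by simp
      qed
    qed
    have DV: "Domain G' \<subseteq> V" "Domain G \<subseteq> Domain G'"
      using G'VW sub by auto
    have fdD: "fd_subspace s1 (Domain G')"
      using DV V vs1.fd_subspace_mono subspace_Domain[OF G'] by blast
    have "vs1.dim (Domain G) \<noteq> vs1.dim (Domain G')"
      using vs1.dim_fd_subspace(2)[OF fdD subspace_Domain[OF G]] DV(2) vD vw(2) by auto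
    moreover have "vs1.dim (Domain G) \<le> vs1.dim (Domain G')"
      by (rule vs1.dim_fd_subspace(1)[OF fdD subspace_Domain[OF G] DV(2)])
    moreover have "vs1.dim (Domain G') \<le> vs1.dim V"
      by (rule vs1.dim_fd_subspace(1)[OF V subspace_Domain[OF G'] DV(1)])
    ultimately have "vs1.dim V - vs1.dim (Domain G') < vs1.dim V - vs1.dim (Domain G)"
      by linarith
    from less.hyps[OF this G' G'VW G'C G'R] obtain G'' where
      "G' \<subseteq> G''" "partial_iso s1 s2 G''" "Domain G'' = V" "Range G'' = W" "G'' \<subseteq> C"
      "compatible G'' I F H"
      by blast
    with sub show ?thesis
      by (intro exI[of _ G'']) auto
  qed
qed

text \<open>Without a constraint any two vectors outside domain and range may be paired; by the
  dimension count \<open>H i\<close> is not exhausted as long as \<open>F i\<close> is not.\<close>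

lemma partial_iso_extend_UNIV:
  assumes "partial_iso s1 s2 G" "G \<subseteq> V \<times> W" "compatible G I F H"
  shows "\<exists>G'. G \<subseteq> G' \<and> partial_iso s1 s2 G' \<and> Domain G' = V \<and> Range G' = W \<and> compatible G' I F H"
proof -
  have "\<exists>v w. v \<in> F i \<and> v \<notin> Domain G \<and> w \<in> H i \<and> w \<notin> Range G \<and> (v, w) \<in> UNIV"
    if G: "partial_iso s1 s2 G" "compatible G I F H" and i: "i \<in> I" "\<not> F i \<subseteq> Domain G" for G i
  proof -
    have "\<not> H i \<subseteq> Range G"
      using Domain_supset[OF G(1) fd_flag[OF i(1)] dim[OF i(1)]] compatibleD[OF G(2) i(1)] i(2) by auto
    then show ?thesis using i(2) by auto
  qed
  moreover have "linear_relation s1 s2 UNIV"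
    by (simp add: linear_relation_def)
  ultimately show ?thesis
    using partial_iso_extend[of UNIV G] assms by simp
qed

text \<open>Meant for an arrow k -> k + 1 with \<open>G'\<close> given at k + 1. A partner
  \<open>w\<close> of \<open>v\<close> is prescribed only modulo the kernel of \<open>g\<close>; it
  has to lie in the right flag member and outside the range built so far. If the candidate is
  already used, the search moves into the kernels.\<close>

lemma partial_iso_lift:
  assumes f: "linear_map_on s1 s1 V V' f" and g: "linear_map_on s2 s2 W W' g"
    and G': "partial_iso s1 s2 G'" "f ` V \<subseteq> Domain G'" "g ` W \<subseteq> Range G'"
      "compatible G' I (\<lambda>i. f ` F i) (\<lambda>i. g ` H i)"
  shows "\<exists>G. partial_iso s1 s2 G \<and> Domain G = V \<and> Range G = W \<and> compatible G I F H \<and>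
    (\<forall>v w. (v, w) \<in> G \<longrightarrow> (f v, g w) \<in> G')"
proof -
  define C where "C = {(v, w). v \<in> V \<and> w \<in> W \<and> (f v, g w) \<in> G'}"
  note sV = vs1.fd_subspaceD[OF V] and sW = vs2.fd_subspaceD[OF W]
  interpret e1: vector_space_pair s1 s1 ..
  interpret e2: vector_space_pair s2 s2 ..
  have "linear_relation s1 s2 C"
    unfolding linear_relation_def C_def
    using vs1.subspace_0[OF sV] vs2.subspace_0[OF sW]
    by (auto simp: linear_map_on_0[OF f] linear_map_on_0[OF g] linear_map_on_add[OF f]
      linear_map_on_add[OF g] linear_map_on_scale[OF f] linear_map_on_scale[OF g]
      intro: vs1.subspace_add[OF sV] vs2.subspace_add[OF sW] vs1.subspace_scale[OF sV]
      vs2.subspace_scale[OF sW] partial_iso_0[OF G'(1)] partial_iso_add[OF G'(1)]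
      partial_iso_scale[OF G'(1)])
  moreover have "\<exists>v w. v \<in> F i \<and> v \<notin> Domain G \<and> w \<in> H i \<and> w \<notin> Range G \<and> (v, w) \<in> C"
    if G: "partial_iso s1 s2 G" "G \<subseteq> C" "compatible G I F H" and i: "i \<in> I" "\<not> F i \<subseteq> Domain G" for G i
  proof -
    note sF = conjunct1[OF F[OF i(1)]] and FV = conjunct2[OF F[OF i(1)]]
    note sH = conjunct1[OF H[OF i(1)]] and HW = conjunct2[OF H[OF i(1)]]
    obtain v where v: "v \<in> F i" "v \<notin> Domain G"
      using i(2) by auto
    obtain y where y: "(f v, y) \<in> G'"
      using v(1) FV G'(2) by auto
    then have "y \<in> g ` H i"
      using compatibleD[OF G'(4) i(1)] v(1) by blast
    then obtain w where w: "w \<in> H i" "(f v, g w) \<in> G'"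
      using y by auto
    show ?thesis
    proof (cases "w \<in> Range G")
      case False
      then show ?thesis
        using v w FV HW by (intro exI[of _ v] exI[of _ w]) (auto simp: C_def)
    next
      \<comment> \<open>The candidate \<open>w\<close> is already the partner of \<open>h\<close>.
        Then \<open>v - h\<close> is in the kernel of \<open>f\<close>, still in \<open>F i\<close>
        and outside the domain, so a pair of kernel vectors can be adjoined in place of
        \<open>(v, w)\<close>.\<close>
      case True
      then obtain h where h: "(h, w) \<in> G" by auto
      define X where "X = {v \<in> F i. f v = 0}"
      define Y where "Y = {w \<in> H i. g w = 0}"
      have hF: "h \<in> F i"
        using compatibleD[OF G(3) i(1) h] w(1) by simp
      have "(f h, g w) \<in> G'"
        using h G(2) by (auto simp: C_def)
      then have "f h = f v"
        using w(2) partial_iso_unique_left[OF G'(1)] by blast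
      moreover have "f v = f (v - h) + f h"
        using linear_map_on_add[OF f, of "v - h" h] FV hF v(1) vs1.subspace_diff[OF sF] by auto
      ultimately have "v - h \<in> X"
        using v(1) hF vs1.subspace_diff[OF sF] by (simp add: X_def)
      moreover have "v - h \<notin> Domain G"
        using vs1.subspace_add[OF subspace_Domain[OF G(1)], of "v - h" h] h v(2) by auto
      ultimately have nX: "\<not> X \<subseteq> Domain G" by blast
      have fF: "linear_map_on s1 s1 (F i) UNIV f" and gH: "linear_map_on s2 s2 (H i) UNIV g"
        using linear_map_on_subset[OF f FV] linear_map_on_subset[OF g HW] by auto
      have fdX: "fd_subspace s1 X" and fdY: "fd_subspace s2 Y"
        using vs1.fd_subspace_mono[OF fd_flag(1)[OF i(1)] e1.subspace_kernel_on[OF fF sF]]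
          vs2.fd_subspace_mono[OF fd_flag(2)[OF i(1)] e2.subspace_kernel_on[OF gH sH]]
        by (auto simp: X_def Y_def)
      have "G' `` (f ` F i) = g ` H i"
      proof -
        have "g ` H i \<subseteq> Range G'"
          using HW G'(3) by blast
        then show ?thesis
          using compatibleD[OF G'(4) i(1)] by blast
      qed
      then have "vs2.dim (g ` H i) = vs1.dim (f ` F i)"
        using partial_iso_Image(2)[OF G'(1) e1.rank_nullity(1)[OF fF fd_flag(1)[OF i(1)]]] FV G'(2)
        by (metis image_mono subset_trans)
      \<comment> \<open>Rank-nullity on \<open>F i\<close> and \<open>H i\<close>: their dimensions
        agree, and so do those of their images, which \<open>G'\<close> matches.\<close>
      then have dXY: "vs1.dim X = vs2.dim Y"
        using e1.rank_nullity(2)[OF fF fd_flag(1)[OF i(1)]]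
          e2.rank_nullity(2)[OF gH fd_flag(2)[OF i(1)]] dim[OF i(1)]
        by (simp add: X_def Y_def)
      have "G\<inverse> `` Y \<subseteq> X"
      proof
        fix x assume "x \<in> G\<inverse> `` Y"
        then obtain y where y: "(x, y) \<in> G" "y \<in> H i" "g y = 0"
          by (auto simp: Y_def)
        then have "x \<in> F i" "(f x, 0) \<in> G'"
          using compatibleD[OF G(3) i(1)] G(2) by (auto simp: C_def)
        then show "x \<in> X"
          using partial_iso_0_iff[OF G'(1)] by (auto simp: X_def)
      qed
      then have "\<not> Y \<subseteq> Range G"
        using Domain_supset[OF G(1) fdX fdY dXY] nX by blast
      then obtain w' where w': "w' \<in> Y" "w' \<notin> Range G" by blast
      have "(v - h, w') \<in> C"
        using \<open>v - h \<in> X\<close> w'(1) FV HW partial_iso_0[OF G'(1)] by (auto simp: C_def X_def Y_def)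
      then show ?thesis
        using \<open>v - h \<in> X\<close> \<open>v - h \<notin> Domain G\<close> w' by (auto simp: X_def Y_def)
    qed
  qed
  moreover have "partial_iso s1 s2 {(0, 0)}" "{(0, 0)} \<subseteq> V \<times> W" "{(0, 0)} \<subseteq> C" "compatible {(0, 0)} I F H"
    using calculation(1) vs1.subspace_0[OF sV] vs2.subspace_0[OF sW] F H
    by (auto simp: partial_iso_def linear_relation_def compatible_def vs1.subspace_0 vs2.subspace_0)
  ultimately obtain G where "partial_iso s1 s2 G" "Domain G = V" "Range G = W" "G \<subseteq> C"
    "compatible G I F H"
    using partial_iso_extend[of C "{(0, 0)}"] by blast
  then show ?thesis
    by (intro exI[of _ G]) (auto simp: C_def)
qed

text \<open>Meant for an arrow k + 1 -> k with \<open>G'\<close> given at k + 1. The image pairs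
  form a partial isomorphism because {0} belongs to the flag: compatibility with its preimages says
  that \<open>G'\<close> matches the kernels of \<open>f\<close> and \<open>g\<close>. Outside the
  images there is no constraint left.\<close>

lemma partial_iso_push:
  assumes f: "linear_map_on s1 s1 V' V f" and g: "linear_map_on s2 s2 W' W g"
    and G': "partial_iso s1 s2 G'" "Domain G' = V'" "Range G' = W'"
      "compatible G' I (\<lambda>i. {v \<in> V'. f v \<in> F i}) (\<lambda>i. {w \<in> W'. g w \<in> H i})"
    and bot: "i \<in> I" "F i = {0}" "H i = {0}"
  shows "\<exists>G. partial_iso s1 s2 G \<and> Domain G = V \<and> Range G = W \<and> compatible G I F H \<and>
    (\<forall>v w. (v, w) \<in> G' \<longrightarrow> (f v, g w) \<in> G)"
proof -
  define G where "G = {(f v, g w) | v w. (v, w) \<in> G'}"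
  have D: "v \<in> V'" "w \<in> W'" if "(v, w) \<in> G'" for v w
    using that G'(2,3) by auto
  have comp: "f v \<in> F j \<longleftrightarrow> g w \<in> H j" if "(v, w) \<in> G'" "j \<in> I" for v w j
    using compatibleD[OF G'(4) that(2,1)] D[OF that(1)] by simp
  have "partial_iso s1 s2 G"
    unfolding partial_iso_def linear_relation_def
  proof (intro conjI allI impI)
    have "f 0 = 0" "g 0 = 0"
      using linear_map_on_0[OF f] linear_map_on_0[OF g] D[OF partial_iso_0[OF G'(1)]] by auto
    then show "(0, 0) \<in> G"
      unfolding G_def using partial_iso_0[OF G'(1)] by fastforce
    show "(x + x', y + y') \<in> G" if xy: "(x, y) \<in> G" "(x', y') \<in> G" for x y x' y'
    proof -
      obtain v w where 1: "(v, w) \<in> G'" "x = f v" "y = g w"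
        using xy(1) by (auto simp: G_def)
      obtain v' w' where 2: "(v', w') \<in> G'" "x' = f v'" "y' = g w'"
        using xy(2) by (auto simp: G_def)
      have "(f (v + v'), g (w + w')) \<in> G"
        using partial_iso_add[OF G'(1) 1(1) 2(1)] by (auto simp: G_def)
      then show ?thesis
        using 1 2 D linear_map_on_add[OF f] linear_map_on_add[OF g] by metis
    qed
    show "(s1 c x, s2 c y) \<in> G" if xy: "(x, y) \<in> G" for c x y
    proof -
      obtain v w where 1: "(v, w) \<in> G'" "x = f v" "y = g w"
        using xy(1) by (auto simp: G_def)
      have "(f (s1 c v), g (s2 c w)) \<in> G"
        using partial_iso_scale[OF G'(1) 1(1)] by (auto simp: G_def)
      then show ?thesis
        using 1 D linear_map_on_scale[OF f] linear_map_on_scale[OF g] by metis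
    qed
    show "x = 0 \<longleftrightarrow> y = 0" if "(x, y) \<in> G" for x y
      using that comp[OF _ bot(1)] bot(2,3) by (auto simp: G_def)
  qed
  moreover have "G \<subseteq> V \<times> W"
    using D linear_map_on_mem[OF f] linear_map_on_mem[OF g] by (auto simp: G_def)
  moreover have "compatible G I F H"
    using comp by (auto simp: compatible_def G_def)
  ultimately obtain G2 where "G \<subseteq> G2" "partial_iso s1 s2 G2" "Domain G2 = V" "Range G2 = W"
    "compatible G2 I F H"
    using partial_iso_extend_UNIV[of G] by blast
  then show ?thesis
    by (intro exI[of _ G2]) (auto simp: G_def)
qed

end

section \<open>Zigzag posets\<close>

locale zigzag =
  fixes n :: nat and r :: "nat rel"
  assumes zigzag: "zigzag_poset n r"
begin

lemma order: "r \<subseteq> {1..n} \<times> {1..n}" "refl_on {1..n} r" "trans r" "antisym r"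
  using zigzag by (auto simp: zigzag_poset_def partial_order_on_def preorder_on_def)

lemma mem_order: "(x, y) \<in> r \<Longrightarrow> 1 \<le> x" "(x, y) \<in> r \<Longrightarrow> x \<le> n"
  "(x, y) \<in> r \<Longrightarrow> 1 \<le> y" "(x, y) \<in> r \<Longrightarrow> y \<le> n"
  using order(1) by auto

lemma order_refl: "1 \<le> x \<Longrightarrow> x \<le> n \<Longrightarrow> (x, x) \<in> r"
  using order(2) by (auto simp: refl_on_def)

lemma order_trans: "(x, y) \<in> r \<Longrightarrow> (y, z) \<in> r \<Longrightarrow> (x, z) \<in> r"
  using order(3) by (rule transD)

lemma order_antisym: "(x, y) \<in> r \<Longrightarrow> (y, x) \<in> r \<Longrightarrow> x = y"
  using order(4) by (rule antisymD)

lemma up_or_down: "1 \<le> k \<Longrightarrow> k < n \<Longrightarrow> (k, Suc k) \<in> r \<or> (Suc k, k) \<in> r"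
  using zigzag by (auto simp: zigzag_poset_def hasse_arrow_def)

lemma not_up_and_down: "(k, Suc k) \<in> r \<Longrightarrow> (Suc k, k) \<notin> r"
  using order_antisym by fastforce

text \<open>Comparabilities are directed paths along consecutive vertices. One that is not an arrow
  passes through an intermediate \<open>z\<close> and splits into two smaller order intervals; if
  the numerical direction turned at \<open>z\<close>, an edge at \<open>z\<close> would be oriented
  both ways.\<close>

lemma order_monotone:
  "(x, y) \<in> r \<Longrightarrow> x \<le> y \<and> (\<forall>k\<in>{x..<y}. (k, Suc k) \<in> r) \<or> y \<le> x \<and> (\<forall>k\<in>{y..<x}. (Suc k, k) \<in> r)"
proof (induction "card {z. (x, z) \<in> r \<and> (z, y) \<in> r}" arbitrary: x y rule: less_induct)
  case less
  let ?I = "\<lambda>x y. {z. (x, z) \<in> r \<and> (z, y) \<in> r}"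
  have fin: "finite (?I x y)"
    by (rule finite_subset[of _ "{1..n}"]) (use order(1) in auto)
  show ?case
  proof (cases "hasse_arrow r x y \<or> x = y")
    case True
    then show ?thesis
    proof
      assume h: "hasse_arrow r x y"
      then have "y = x + 1 \<or> x = y + 1" "(x, y) \<in> r"
        using zigzag by (auto simp: zigzag_poset_def hasse_arrow_def)
      then show ?thesis by (auto simp: less_Suc_eq)
    qed simp
  next
    case False
    then obtain z where z: "(x, z) \<in> r" "(z, y) \<in> r" "z \<noteq> x" "z \<noteq> y"
      using less.prems by (auto simp: hasse_arrow_def)
    have "y \<notin> ?I x z" "x \<notin> ?I z y"
      using z order_antisym by auto
    moreover have "?I x z \<subseteq> ?I x y" "?I z y \<subseteq> ?I x y"
      using z order_trans by blast+
    moreover have "x \<in> ?I x y" "y \<in> ?I x y"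
      using less.prems order_refl mem_order by blast+
    ultimately have "?I x z \<subset> ?I x y" "?I z y \<subset> ?I x y"
      by blast+
    then have IH:
      "x \<le> z \<and> (\<forall>k\<in>{x..<z}. (k, Suc k) \<in> r) \<or> z \<le> x \<and> (\<forall>k\<in>{z..<x}. (Suc k, k) \<in> r)"
      "z \<le> y \<and> (\<forall>k\<in>{z..<y}. (k, Suc k) \<in> r) \<or> y \<le> z \<and> (\<forall>k\<in>{y..<z}. (Suc k, k) \<in> r)"
      using less.hyps[OF psubset_card_mono[OF fin] z(1)] less.hyps[OF psubset_card_mono[OF fin] z(2)]
      by blast+
    consider "x < z" "z < y" | "z < x" "y < z" | "x < z" "y < z" | "z < x" "z < y"
      using z(3,4) by linarith
    then show ?thesis
    proof cases
      case 1
      then show ?thesis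
        using IH by (metis atLeastLessThan_iff less_or_eq_imp_le linorder_not_less order.strict_trans)
    next
      case 2
      then show ?thesis
        using IH by (metis atLeastLessThan_iff less_or_eq_imp_le linorder_not_less order.strict_trans)
    next
      case 3
      then obtain z' where "z = Suc z'"
        by (cases z) auto
      then have "(z', Suc z') \<in> r" "(Suc z', z') \<in> r"
        using IH 3 by auto
      then show ?thesis using not_up_and_down by blast
    next
      case 4
      then have "(z, Suc z) \<in> r" "(Suc z, z) \<in> r"
        using IH by auto
      then show ?thesis using not_up_and_down by blast
    qed
  qed
qed

lemma order_up: "(x, y) \<in> r \<Longrightarrow> x \<le> k \<Longrightarrow> k < y \<Longrightarrow> (k, Suc k) \<in> r"
  using order_monotone[of x y] by auto

lemma order_down: "(x, y) \<in> r \<Longrightarrow> y \<le> k \<Longrightarrow> k < x \<Longrightarrow> (Suc k, k) \<in> r"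
  using order_monotone[of x y] by auto

lemma chain_up: "x \<le> y \<Longrightarrow> 1 \<le> x \<Longrightarrow> y \<le> n \<Longrightarrow> (\<And>k. x \<le> k \<Longrightarrow> k < y \<Longrightarrow> (k, Suc k) \<in> r) \<Longrightarrow> (x, y) \<in> r"
  by (induction y rule: dec_induct) (auto intro: order_refl order_trans)

lemma chain_down: "x \<le> y \<Longrightarrow> 1 \<le> x \<Longrightarrow> y \<le> n \<Longrightarrow> (\<And>k. x \<le> k \<Longrightarrow> k < y \<Longrightarrow> (Suc k, k) \<in> r) \<Longrightarrow> (y, x) \<in> r"
  by (induction y rule: dec_induct) (auto intro: order_refl order_trans)

section \<open>Sources and sinks of an interval that grows to the right\<close>

lemma order_to_Suc: "(j, Suc j) \<in> r \<Longrightarrow> x \<le> j \<Longrightarrow> (x, Suc j) \<in> r \<longleftrightarrow> (x, j) \<in> r"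
  using chain_up[of x j] order_up[of x "Suc j"] mem_order[of x "Suc j"] order_trans[of x j "Suc j"]
  by auto

lemma order_from_Suc: "(Suc j, j) \<in> r \<Longrightarrow> x \<le> j \<Longrightarrow> (Suc j, x) \<in> r \<longleftrightarrow> (j, x) \<in> r"
  using chain_down[of x j] order_down[of "Suc j" x] mem_order[of "Suc j" x] order_trans[of "Suc j" j x]
  by auto

lemma not_down_Suc: "(j, Suc j) \<in> r \<Longrightarrow> x \<le> j \<Longrightarrow> (Suc j, x) \<notin> r"
  using order_down[of "Suc j" x j] not_up_and_down by auto

lemma not_up_Suc: "(Suc j, j) \<in> r \<Longrightarrow> x \<le> j \<Longrightarrow> (x, Suc j) \<notin> r"
  using order_up[of x "Suc j" j] not_up_and_down by auto

text \<open>The new vertex lies above \<open>j\<close>, and an old vertex below it is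
  \<open>j\<close> or lies below \<open>j\<close>. So it is maximal, takes maximality away from
  \<open>j\<close> alone, and does not affect minimal elements.\<close>

lemma extremal_elements_Suc_up:
  assumes "i \<le> j" "(j, Suc j) \<in> r"
  shows "minimal_elements r {i..Suc j} = minimal_elements r {i..j}"
    and "maximal_elements r {i..Suc j} = insert (Suc j) (maximal_elements r {i..j} - {j})"
proof -
  have I: "{i..Suc j} = insert (Suc j) {i..j}" using assms by auto
  note lem = assms not_down_Suc[OF assms(2)] order_to_Suc[OF assms(2)]
  show "minimal_elements r {i..Suc j} = minimal_elements r {i..j}"
    unfolding minimal_elements_def I using lem by (auto intro!: bexI[of _ j])
  show "maximal_elements r {i..Suc j} = insert (Suc j) (maximal_elements r {i..j} - {j})"
    unfolding maximal_elements_def I using lem by auto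
qed

lemma extremal_elements_Suc_down:
  assumes "i \<le> j" "(Suc j, j) \<in> r"
  shows "maximal_elements r {i..Suc j} = maximal_elements r {i..j}"
    and "minimal_elements r {i..Suc j} = insert (Suc j) (minimal_elements r {i..j} - {j})"
proof -
  have I: "{i..Suc j} = insert (Suc j) {i..j}" using assms by auto
  note lem = assms not_up_Suc[OF assms(2)] order_from_Suc[OF assms(2)]
  show "maximal_elements r {i..Suc j} = maximal_elements r {i..j}"
    unfolding maximal_elements_def I using lem by (auto intro!: bexI[of _ j])
  show "minimal_elements r {i..Suc j} = insert (Suc j) (minimal_elements r {i..j} - {j})"
    unfolding minimal_elements_def I using lem by auto
qed

text \<open>For \<open>i < j\<close> these are the two components of \<open>S_pair r i j\<close>. On a one-point interval the
  vertex counts as a source or as a sink according to the arrow that leaves it to the right, so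
  that the recursion over \<open>j\<close> can start at \<open>j = i\<close>.\<close>

definition sources :: "nat \<Rightarrow> nat \<Rightarrow> nat set" where
  "sources i j = (if i < j then minimal_elements r {i..j} else if (i, Suc i) \<in> r then {i} else {})"

definition sinks :: "nat \<Rightarrow> nat \<Rightarrow> nat set" where
  "sinks i j = (if i < j then maximal_elements r {i..j} else if (i, Suc i) \<in> r then {} else {i})"

lemma extremal_elements_singleton:
  "minimal_elements r {i..i} = {i}" "maximal_elements r {i..i} = {i}"
  by (auto simp: minimal_elements_def maximal_elements_def)

lemma sources_sinks_Suc_up:
  assumes "i \<le> j" "(j, Suc j) \<in> r"
  shows "sources i (Suc j) = sources i j" "sinks i (Suc j) = insert (Suc j) (sinks i j - {j})"
  using assms extremal_elements_Suc_up[OF assms] extremal_elements_singleton[of i]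
  by (cases "i = j"; force simp: sources_def sinks_def)+

lemma sources_sinks_Suc_down:
  assumes "i \<le> j" "(Suc j, j) \<in> r"
  shows "sinks i (Suc j) = sinks i j" "sources i (Suc j) = insert (Suc j) (sources i j - {j})"
  using assms extremal_elements_Suc_down[OF assms] extremal_elements_singleton[of i] not_up_and_down[of j]
  by (cases "i = j"; force simp: sources_def sinks_def)+

lemma sources_sinks_subset: "i \<le> j \<Longrightarrow> sources i j \<subseteq> {i..j}" "i \<le> j \<Longrightarrow> sinks i j \<subseteq> {i..j}"
  by (auto simp: sources_def sinks_def minimal_elements_def maximal_elements_def)

lemma below_source: "x \<in> sources i j \<Longrightarrow> y \<in> sources i j \<Longrightarrow> (x, y) \<in> r \<Longrightarrow> x = y"
  by (auto simp: sources_def minimal_elements_def split: if_splits)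

lemma above_sink: "x \<in> sinks i j \<Longrightarrow> y \<in> sinks i j \<Longrightarrow> (x, y) \<in> r \<Longrightarrow> x = y"
  by (auto simp: sinks_def maximal_elements_def split: if_splits)

text \<open>The last arrow decides; on a one-point interval the convention in \<open>sources\<close>
  and \<open>sinks\<close> selects exactly one of the two.\<close>

lemma source_or_sink:
  assumes "1 \<le> i" "i \<le> j" "j \<le> n"
  shows "j \<in> sources i j \<longleftrightarrow> j \<notin> sinks i j"
  using assms(2,1,3)
proof (induction j rule: dec_induct)
  case base
  then show ?case by (auto simp: sources_def sinks_def)
next
  case (step j)
  then show ?case
    using up_or_down[of j] sources_sinks_Suc_up[of i j] sources_sinks_Suc_down[of i j]
      sources_sinks_subset[of i j] by auto
qed

end

section \<open>Transported subspaces\<close>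

locale zigzag_module = zigzag n r for n r +
  fixes M :: "(nat, 'k::field, 'v::ab_group_add) pmodule"
  assumes module: "persistence_module {1..n} r M"
    and finite_dim: "pointwise_finite_dimensional {1..n} M"
begin

lemma vector_space: "vector_space (scal M)"
  using module by (simp add: persistence_module_def)

lemma fd_space: "1 \<le> x \<Longrightarrow> x \<le> n \<Longrightarrow> fd_subspace (scal M) (space_at M x)"
  using module finite_dim
  by (auto simp: persistence_module_def pointwise_finite_dimensional_def fd_subspace_def)

lemma subspace_space: "1 \<le> x \<Longrightarrow> x \<le> n \<Longrightarrow> module.subspace (scal M) (space_at M x)"
  using fd_space by (simp add: fd_subspace_def)

lemma linear_map:
  "(x, y) \<in> r \<Longrightarrow> linear_map_on (scal M) (scal M) (space_at M x) (space_at M y) (map_at M y x)"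
  using module by (simp add: persistence_module_def)

lemma map_mem: "(x, y) \<in> r \<Longrightarrow> v \<in> space_at M x \<Longrightarrow> map_at M y x v \<in> space_at M y"
  using linear_map by (rule linear_map_on_mem)

lemma map_id: "1 \<le> x \<Longrightarrow> x \<le> n \<Longrightarrow> v \<in> space_at M x \<Longrightarrow> map_at M x x v = v"
  using module by (simp add: persistence_module_def)

lemma map_comp: "(x, y) \<in> r \<Longrightarrow> (y, z) \<in> r \<Longrightarrow> v \<in> space_at M x \<Longrightarrow>
    map_at M z y (map_at M y x v) = map_at M z x v"
  using module unfolding persistence_module_def by blast

lemma zero_mem: "1 \<le> x \<Longrightarrow> x \<le> n \<Longrightarrow> 0 \<in> space_at M x"
proof -
  interpret vector_space "scal M" by (rule vector_space)
  show "1 \<le> x \<Longrightarrow> x \<le> n \<Longrightarrow> 0 \<in> space_at M x"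
    using subspace_0 subspace_space by blast
qed

lemma map_0: "(x, y) \<in> r \<Longrightarrow> map_at M y x 0 = 0"
  using linear_map_on_0[OF linear_map] zero_mem mem_order by blast

end

text \<open>The subspace \<open>transport M r a b k\<close> of \<open>space_at M k\<close> arises from \<open>space_at M a\<close> (if \<open>b\<close>) or
  \<open>{0}\<close> (if not \<open>b\<close>) at \<open>a \<le> k\<close> by taking images along arrows \<open>l \<rightarrow> l + 1\<close> and preimages along
  arrows \<open>l + 1 \<rightarrow> l\<close>; for \<open>k < a\<close> it is a junk value.\<close>

primrec transport ::
    "(nat, 'k, 'v::ab_group_add) pmodule \<Rightarrow> nat rel \<Rightarrow> nat \<Rightarrow> bool \<Rightarrow> nat \<Rightarrow> 'v set" where
  "transport M r a b 0 = (if b then space_at M a else {0})"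
| "transport M r a b (Suc k) =
     (if Suc k \<le> a then (if b then space_at M a else {0})
      else if (k, Suc k) \<in> r then map_at M (Suc k) k ` transport M r a b k
      else {v \<in> space_at M (Suc k). map_at M k (Suc k) v \<in> transport M r a b k})"

lemma transport_start: "transport M r a b a = (if b then space_at M a else {0})"
  by (cases a) auto

lemma transport_up: "a \<le> k \<Longrightarrow> (k, Suc k) \<in> r \<Longrightarrow>
    transport M r a b (Suc k) = map_at M (Suc k) k ` transport M r a b k"
  by simp

lemma transport_down: "a \<le> k \<Longrightarrow> (k, Suc k) \<notin> r \<Longrightarrow>
    transport M r a b (Suc k) = {v \<in> space_at M (Suc k). map_at M k (Suc k) v \<in> transport M r a b k}"
  by simp

declare transport.simps(2) [simp del]

context zigzag_module
begin

lemma transport_subspace: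
  assumes "1 \<le> a" "a \<le> k" "k \<le> n"
  shows "module.subspace (scal M) (transport M r a b k) \<and> transport M r a b k \<subseteq> space_at M k"
  using assms(2,1,3)
proof (induction k rule: dec_induct)
  case base
  interpret vector_space "scal M" by (rule vector_space)
  show ?case
    using base by (auto simp: transport_start subspace_space zero_mem)
next
  case (step k)
  interpret vector_space_pair "scal M" "scal M"
    by (simp add: vector_space_pair_def vector_space)
  have IH: "vs1.subspace (transport M r a b k)" "transport M r a b k \<subseteq> space_at M k"
    using step by auto
  show ?case
  proof (cases "(k, Suc k) \<in> r")
    case True
    have "linear_map_on (scal M) (scal M) (transport M r a b k) (space_at M (Suc k)) (map_at M (Suc k) k)"
      using linear_map_on_subset[OF linear_map[OF True] IH(2)] map_mem[OF True] IH(2) by blast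
    then show ?thesis
      using True step(1) IH map_mem[OF True] subspace_image_on[OF _ IH(1)] by (auto simp: transport_up)
  next
    case False
    then have d: "(Suc k, k) \<in> r"
      using up_or_down[of k] step by auto
    show ?thesis
      using False step subspace_preimage_on[OF linear_map[OF d] subspace_space IH(1)]
      by (simp add: transport_down)
  qed
qed

end

section \<open>Building an isomorphism of modules from right to left\<close>

locale zigzag_module_pair = M: zigzag_module n r M + N: zigzag_module n r N
  for n r and M :: "(nat, 'k::field, 'v::ab_group_add) pmodule"
    and N :: "(nat, 'k, 'w::ab_group_add) pmodule"
begin

lemma vector_space_pair: "vector_space_pair (scal M) (scal N)"
  by (simp add: vector_space_pair_def M.vector_space N.vector_space)

text \<open>At the later of the two starting points one member is {0} or the whole space, so the
  direction of the inclusion there depends on its start value only and is the same for both modules.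
  Images and preimages preserve inclusions.\<close>

lemma transport_chain:
  assumes "1 \<le> a" "a \<le> k" "1 \<le> a'" "a' \<le> k" "k \<le> n"
  shows "transport M r a b k \<subseteq> transport M r a' b' k \<and> transport N r a b k \<subseteq> transport N r a' b' k \<or>
    transport M r a' b' k \<subseteq> transport M r a b k \<and> transport N r a' b' k \<subseteq> transport N r a b k"
proof -
  define T1 where "T1 = (\<lambda>a b k. transport M r a b k)"
  define T2 where "T2 = (\<lambda>a b k. transport N r a b k)"
  define P where "P k a b a' b' \<longleftrightarrow> T1 a b k \<subseteq> T1 a' b' k \<and> T2 a b k \<subseteq> T2 a' b' k \<or>
    T1 a' b' k \<subseteq> T1 a b k \<and> T2 a' b' k \<subseteq> T2 a b k" for k a b a' b'
  have start: "P a' a b a' b'" if "1 \<le> a" "a \<le> a'" "a' \<le> n" for a b a' b'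
  proof -
    interpret M: vector_space "scal M" by (rule M.vector_space)
    interpret N: vector_space "scal N" by (rule N.vector_space)
    show ?thesis
      using M.transport_subspace[OF that, of b] N.transport_subspace[OF that, of b]
        M.subspace_0[of "T1 a b a'"] N.subspace_0[of "T2 a b a'"]
      by (cases b') (auto simp: P_def T1_def T2_def transport_start)
  qed
  have "P k a b a' b'" if "a \<le> a'" "a' \<le> k" "1 \<le> a" "k \<le> n" for a b a' b'
    using that(2,1,3,4)
  proof (induction k rule: dec_induct)
    case base
    then show ?case using start by simp
  next
    case (step k)
    then have "P k a b a' b'" by simp
    moreover have "a \<le> k" using step by simp
    ultimately show ?case
      using step(1) unfolding P_def T1_def T2_def
      by (cases "(k, Suc k) \<in> r") (simp_all add: transport_up transport_down, blast+)
  qed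
  then have "P k a b a' b' \<or> P k a' b' a b"
    using assms nat_le_linear by blast
  then show ?thesis
    unfolding P_def T1_def T2_def by blast
qed

definition flag_iso :: "nat \<Rightarrow> ('v \<times> 'w) set \<Rightarrow> bool" where
  "flag_iso k G \<longleftrightarrow> partial_iso (scal M) (scal N) G \<and> Domain G = space_at M k \<and> Range G = space_at N k \<and>
     compatible G ({1..k} \<times> UNIV) (\<lambda>(a, b). transport M r a b k) (\<lambda>(a, b). transport N r a b k)"

definition flag_iso_family :: "nat \<Rightarrow> (nat \<Rightarrow> ('v \<times> 'w) set) \<Rightarrow> bool" where
  "flag_iso_family k \<Phi> \<longleftrightarrow>
     (\<forall>l. 1 \<le> l \<longrightarrow> l \<le> k \<longrightarrow> flag_iso l (\<Phi> l)) \<and>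
     (\<forall>l v w. 1 \<le> l \<longrightarrow> l < k \<longrightarrow> (l, Suc l) \<in> r \<longrightarrow> (v, w) \<in> \<Phi> l \<longrightarrow>
       (map_at M (Suc l) l v, map_at N (Suc l) l w) \<in> \<Phi> (Suc l)) \<and>
     (\<forall>l v w. 1 \<le> l \<longrightarrow> l < k \<longrightarrow> (Suc l, l) \<in> r \<longrightarrow> (v, w) \<in> \<Phi> (Suc l) \<longrightarrow>
       (map_at M l (Suc l) v, map_at N l (Suc l) w) \<in> \<Phi> l)"

lemma flag_iso_familyD:
  assumes "flag_iso_family k \<Phi>"
  shows "1 \<le> l \<Longrightarrow> l \<le> k \<Longrightarrow> flag_iso l (\<Phi> l)"
    and "1 \<le> l \<Longrightarrow> l < k \<Longrightarrow> (l, Suc l) \<in> r \<Longrightarrow> (v, w) \<in> \<Phi> l \<Longrightarrow>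
       (map_at M (Suc l) l v, map_at N (Suc l) l w) \<in> \<Phi> (Suc l)"
    and "1 \<le> l \<Longrightarrow> l < k \<Longrightarrow> (Suc l, l) \<in> r \<Longrightarrow> (v, w) \<in> \<Phi> (Suc l) \<Longrightarrow>
       (map_at M l (Suc l) v, map_at N l (Suc l) w) \<in> \<Phi> l"
  using assms unfolding flag_iso_family_def by simp_all

context
  assumes dim_transport: "\<And>a k b. 1 \<le> a \<Longrightarrow> a \<le> k \<Longrightarrow> k \<le> n \<Longrightarrow>
    vector_space.dim (scal M) (transport M r a b k) = vector_space.dim (scal N) (transport N r a b k)"
begin

lemma flags:
  assumes "1 \<le> k" "k \<le> n"
  shows "flag_pair (scal M) (scal N) (space_at M k) (space_at N k) ({1..k} \<times> UNIV)
    (\<lambda>(a, b). transport M r a b k) (\<lambda>(a, b). transport N r a b k) (k, True)"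
proof -
  interpret vector_space_pair "scal M" "scal N" by (rule vector_space_pair)
  show ?thesis
  proof (unfold_locales, goal_cases)
    case 1
    show ?case using assms by (rule M.fd_space)
  next
    case 2
    show ?case using assms by (rule N.fd_space)
  next
    case (3 i)
    then show ?case
      using M.transport_subspace[of "fst i" k "snd i"] assms by (auto split: prod.splits)
  next
    case (4 i)
    then show ?case
      using N.transport_subspace[of "fst i" k "snd i"] assms by (auto split: prod.splits)
  next
    case (5 i)
    then show ?case
      using dim_transport[of "fst i" k "snd i"] assms by (auto split: prod.splits)
  next
    case (6 i j)
    then show ?case
      using transport_chain[of "fst i" k "fst j" "snd i" "snd j"] assms by (auto split: prod.splits)
  qed (use assms in \<open>simp_all add: transport_start\<close>)
qed

lemma flag_iso_exists:
  assumes "1 \<le> k" "k \<le> n"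
  shows "\<exists>G. flag_iso k G"
proof -
  interpret flag_pair "scal M" "scal N" "space_at M k" "space_at N k" "{1..k} \<times> UNIV"
    "\<lambda>(a, b). transport M r a b k" "\<lambda>(a, b). transport N r a b k" "(k, True)"
    using assms by (rule flags)
  have 1: "partial_iso (scal M) (scal N) {(0, 0)}"
    by (simp add: partial_iso_def linear_relation_def)
  have 2: "{(0, 0)} \<subseteq> space_at M k \<times> space_at N k"
    using assms by (simp add: M.zero_mem N.zero_mem)
  have "0 \<in> transport M r a b k" "0 \<in> transport N r a b k" if "a \<in> {1..k}" for a b
    using F[of "(a, b)"] H[of "(a, b)"] that by (auto intro: vs1.subspace_0 vs2.subspace_0)
  then have 3: "compatible {(0, 0)} ({1..k} \<times> UNIV)
     (\<lambda>(a, b). transport M r a b k) (\<lambda>(a, b). transport N r a b k)"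
    by (auto simp: compatible_def)
  show ?thesis
    using partial_iso_extend_UNIV[OF 1 2 3] unfolding flag_iso_def
    by (elim exE conjE) (intro exI conjI)
qed

text \<open>The members at k + 1 that start at some a <= k are the images of the members at k, so
  preserving the flag at k + 1 is what \<open>partial_iso_lift\<close> asks for.\<close>

lemma flag_iso_lift:
  assumes k: "1 \<le> k" "k < n" and up: "(k, Suc k) \<in> r" and G: "flag_iso (Suc k) G"
  shows "\<exists>G'. flag_iso k G' \<and>
    (\<forall>v w. (v, w) \<in> G' \<longrightarrow> (map_at M (Suc k) k v, map_at N (Suc k) k w) \<in> G)"
proof -
  interpret flag_pair "scal M" "scal N" "space_at M k" "space_at N k" "{1..k} \<times> UNIV"
    "\<lambda>(a, b). transport M r a b k" "\<lambda>(a, b). transport N r a b k" "(k, True)"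
    using k by (intro flags) auto
  have comp: "v \<in> transport M r a b (Suc k) \<longleftrightarrow> w \<in> transport N r a b (Suc k)"
    if "(v, w) \<in> G" "a \<in> {1..k}" for v w a b
    using G that compatibleD[of G _ _ _ "(a, b)" v w] unfolding flag_iso_def by fastforce
  have 1: "compatible G ({1..k} \<times> UNIV) (\<lambda>i. map_at M (Suc k) k ` (case i of (a, b) \<Rightarrow> transport M r a b k))
     (\<lambda>i. map_at N (Suc k) k ` (case i of (a, b) \<Rightarrow> transport N r a b k))"
    unfolding compatible_def using comp by (auto simp: transport_up up)
  have 2: "partial_iso (scal M) (scal N) G" "map_at M (Suc k) k ` space_at M k \<subseteq> Domain G"
    "map_at N (Suc k) k ` space_at N k \<subseteq> Range G"
    using G M.map_mem[OF up] N.map_mem[OF up] by (auto simp: flag_iso_def)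
  show ?thesis
    using partial_iso_lift[OF M.linear_map[OF up] N.linear_map[OF up] 2 1]
    unfolding flag_iso_def by (simp only: conj_assoc)
qed

text \<open>Here the members at k + 1 are the preimages, and \<open>(k, False)\<close> names {0} at
  k, whose preimages are the kernels.\<close>

lemma flag_iso_push:
  assumes k: "1 \<le> k" "k < n" and down: "(Suc k, k) \<in> r" and G: "flag_iso (Suc k) G"
  shows "\<exists>G'. flag_iso k G' \<and>
    (\<forall>v w. (v, w) \<in> G \<longrightarrow> (map_at M k (Suc k) v, map_at N k (Suc k) w) \<in> G')"
proof -
  interpret flag_pair "scal M" "scal N" "space_at M k" "space_at N k" "{1..k} \<times> UNIV"
    "\<lambda>(a, b). transport M r a b k" "\<lambda>(a, b). transport N r a b k" "(k, True)"
    using k by (intro flags) auto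
  have nup: "(k, Suc k) \<notin> r"
    using down M.not_up_and_down by blast
  have comp: "v \<in> transport M r a b (Suc k) \<longleftrightarrow> w \<in> transport N r a b (Suc k)"
    if "(v, w) \<in> G" "a \<in> {1..k}" for v w a b
    using G that compatibleD[of G _ _ _ "(a, b)" v w] unfolding flag_iso_def by fastforce
  have 1: "compatible G ({1..k} \<times> UNIV)
     (\<lambda>i. {v \<in> space_at M (Suc k). map_at M k (Suc k) v \<in> (case i of (a, b) \<Rightarrow> transport M r a b k)})
     (\<lambda>i. {v \<in> space_at N (Suc k). map_at N k (Suc k) v \<in> (case i of (a, b) \<Rightarrow> transport N r a b k)})"
    unfolding compatible_def using comp by (auto simp: transport_down nup)
  have 2: "partial_iso (scal M) (scal N) G" "Domain G = space_at M (Suc k)"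
    "Range G = space_at N (Suc k)"
    using G by (auto simp: flag_iso_def)
  have 3: "(k, False) \<in> {1..k} \<times> UNIV"
    "(case (k, False) of (a, b) \<Rightarrow> transport M r a b k) = {0}"
    "(case (k, False) of (a, b) \<Rightarrow> transport N r a b k) = {0}"
    using k by (auto simp: transport_start)
  show ?thesis
    using partial_iso_push[OF M.linear_map[OF down] N.linear_map[OF down] 2 1 3]
    unfolding flag_iso_def by (simp only: conj_assoc)
qed

text \<open>The right end is prescribed because the relation at \<open>k\<close> has to be obtained
  from the one at \<open>Suc k\<close>; it then serves as the prescribed right end of the shorter
  family.\<close>

lemma flag_iso_family_exists:
  assumes "1 \<le> k" "k \<le> n" "flag_iso k G"
  shows "\<exists>\<Phi>. flag_iso_family k \<Phi> \<and> \<Phi> k = G"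
  using assms
proof (induction k arbitrary: G rule: dec_induct)
  case base
  then have "flag_iso_family 1 (\<lambda>_. G)"
    by (auto simp: flag_iso_family_def le_Suc_eq)
  then show ?case by blast
next
  case (step k)
  have k: "1 \<le> k" "k < n" "k \<le> n" using step by auto
  have "\<exists>G'. flag_iso k G' \<and>
    ((k, Suc k) \<in> r \<longrightarrow> (\<forall>v w. (v, w) \<in> G' \<longrightarrow> (map_at M (Suc k) k v, map_at N (Suc k) k w) \<in> G)) \<and>
    ((Suc k, k) \<in> r \<longrightarrow> (\<forall>v w. (v, w) \<in> G \<longrightarrow> (map_at M k (Suc k) v, map_at N k (Suc k) w) \<in> G'))"
    using M.up_or_down[OF k(1,2)] M.not_up_and_down[of k] flag_iso_lift[OF k(1,2) _ step.prems(2)]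
      flag_iso_push[OF k(1,2) _ step.prems(2)] by blast
  then obtain G' where G': "flag_iso k G'"
    "\<And>v w. (k, Suc k) \<in> r \<Longrightarrow> (v, w) \<in> G' \<Longrightarrow> (map_at M (Suc k) k v, map_at N (Suc k) k w) \<in> G"
    "\<And>v w. (Suc k, k) \<in> r \<Longrightarrow> (v, w) \<in> G \<Longrightarrow> (map_at M k (Suc k) v, map_at N k (Suc k) w) \<in> G'"
    by blast
  obtain \<Phi> where \<Phi>: "flag_iso_family k \<Phi>" "\<Phi> k = G'"
    using step.IH[OF k(3) G'(1)] by blast
  let ?\<Phi> = "\<Phi>(Suc k := G)"
  have below: "?\<Phi> l = \<Phi> l" if "l \<le> k" for l
    using that by simp
  have "flag_iso l (?\<Phi> l)" if "1 \<le> l" "l \<le> Suc k" for l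
    using that flag_iso_familyD(1)[OF \<Phi>(1), of l] step.prems(2) by (cases "l = Suc k") auto
  moreover have "(map_at M (Suc l) l v, map_at N (Suc l) l w) \<in> ?\<Phi> (Suc l)"
    if "1 \<le> l" "l < Suc k" "(l, Suc l) \<in> r" "(v, w) \<in> ?\<Phi> l" for l v w
  proof (cases "l = k")
    case True
    then show ?thesis
      using G'(2)[of v w] that(3,4) \<Phi>(2) by simp
  next
    case False
    then show ?thesis
      using flag_iso_familyD(2)[OF \<Phi>(1), of l v w] that below[of l] below[of "Suc l"] by simp
  qed
  moreover have "(map_at M l (Suc l) v, map_at N l (Suc l) w) \<in> ?\<Phi> l"
    if "1 \<le> l" "l < Suc k" "(Suc l, l) \<in> r" "(v, w) \<in> ?\<Phi> (Suc l)" for l v w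
  proof (cases "l = k")
    case True
    then show ?thesis
      using G'(3)[of v w] that(3,4) \<Phi>(2) by simp
  next
    case False
    then show ?thesis
      using flag_iso_familyD(3)[OF \<Phi>(1), of l v w] that below[of l] below[of "Suc l"] by simp
  qed
  ultimately have "flag_iso_family (Suc k) ?\<Phi>"
    unfolding flag_iso_family_def by blast
  moreover have "?\<Phi> (Suc k) = G" by simp
  ultimately show ?case by blast
qed

text \<open>Compatibility with single arrows spreads to all of \<open>r\<close>, since comparable
  vertices are joined by directed paths. The two morphisms are the functions with graphs
  \<open>\<Phi> x\<close> and their converses; naturality and mutual inverseness follow from
  uniqueness of partners.\<close>

lemma isomorphic:
  "pmodule_isomorphic {1..n} r M N"
proof (cases "n = 0")
  case True
  then show ?thesis
    using M.order(1) by (auto simp: pmodule_isomorphic_def pmodule_morphism_def)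
next
  case False
  interpret vector_space_pair "scal M" "scal N" by (rule vector_space_pair)
  interpret c: vector_space_pair "scal N" "scal M" ..
  obtain G where "flag_iso n G"
    using flag_iso_exists[of n] False by auto
  then obtain \<Phi> where fam: "flag_iso_family n \<Phi>"
    using flag_iso_family_exists[of n G] False by auto
  note \<Phi> = flag_iso_familyD[OF fam]
  have iso: "partial_iso (scal M) (scal N) (\<Phi> x)" "Domain (\<Phi> x) = space_at M x"
    "Range (\<Phi> x) = space_at N x" if "1 \<le> x" "x \<le> n" for x
    using \<Phi>(1)[OF that] by (auto simp: flag_iso_def)
  have mem: "v \<in> space_at M x" "w \<in> space_at N x" if "1 \<le> x" "x \<le> n" "(v, w) \<in> \<Phi> x" for x v w
    using iso[OF that(1,2)] that(3) by auto
  have up: "(map_at M y x v, map_at N y x w) \<in> \<Phi> y"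
    if "x \<le> y" "1 \<le> x" "y \<le> n" "(x, y) \<in> r" "(v, w) \<in> \<Phi> x" for x y v w
    using that
  proof (induction y rule: dec_induct)
    case base
    then show ?case
      using mem[of x v w] by (simp add: M.map_id N.map_id)
  next
    case (step y)
    have r: "(x, y) \<in> r" "(y, Suc y) \<in> r"
    proof -
      have up: "(k, Suc k) \<in> r" if "x \<le> k" "k < Suc y" for k
        using M.order_up[OF step.prems(3) that] .
      show "(y, Suc y) \<in> r"
        using up step.hyps by simp
      show "(x, y) \<in> r"
        by (rule M.chain_up) (use step.hyps step.prems(1,2) up in simp_all)
    qed
    have v: "v \<in> space_at M x" and w: "w \<in> space_at N x"
      using mem[of x v w] step.prems step.hyps by simp_all
    have y: "1 \<le> y" "y < n" "y \<le> n"
      using step.hyps step.prems(1,2) by simp_all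
    show ?case
      using \<Phi>(2)[OF y(1,2) r(2) step.IH[OF step.prems(1) y(3) r(1) step.prems(4)]]
      by (simp only: M.map_comp[OF r v] N.map_comp[OF r w])
  qed
  have down: "(map_at M x y v, map_at N x y w) \<in> \<Phi> x"
    if "x \<le> y" "1 \<le> x" "y \<le> n" "(y, x) \<in> r" "(v, w) \<in> \<Phi> y" for x y v w
    using that
  proof (induction y arbitrary: v w rule: dec_induct)
    case base
    then show ?case
      using mem[of x v w] by (simp add: M.map_id N.map_id)
  next
    case (step y)
    have r: "(y, x) \<in> r" "(Suc y, y) \<in> r"
    proof -
      have down: "(Suc k, k) \<in> r" if "x \<le> k" "k < Suc y" for k
        using M.order_down[OF step.prems(3) that] .
      show "(Suc y, y) \<in> r"
        using down step.hyps by simp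
      show "(y, x) \<in> r"
        by (rule M.chain_down) (use step.hyps step.prems(1,2) down in simp_all)
    qed
    have v: "v \<in> space_at M (Suc y)" and w: "w \<in> space_at N (Suc y)"
      using mem[of "Suc y" v w] step.prems step.hyps by simp_all
    have y: "1 \<le> y" "y < n" "y \<le> n"
      using step.hyps step.prems(1,2) by simp_all
    show ?case
      using step.IH[OF step.prems(1) y(3) r(1) \<Phi>(3)[OF y(1,2) r(2) step.prems(4)]]
      by (simp only: M.map_comp[OF r(2,1) v] N.map_comp[OF r(2,1) w])
  qed
  have nat: "(map_at M y x v, map_at N y x w) \<in> \<Phi> y" if "(x, y) \<in> r" "(v, w) \<in> \<Phi> x" for x y v w
    using up[of x y] down[of y x] that M.mem_order[OF that(1)] by (cases "x \<le> y") auto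
  have "\<exists>f. linear_map_on (scal M) (scal N) (space_at M x) (space_at N x) f \<and>
      (\<forall>v\<in>space_at M x. (v, f v) \<in> \<Phi> x)" (is "?f x") if "x \<in> {1..n}" for x
  proof -
    have x: "1 \<le> x" "x \<le> n" using that by auto
    show ?thesis
      using partial_iso_function[OF iso(1)[OF x]] unfolding iso(2,3)[OF x] .
  qed
  then have "\<forall>x\<in>{1..n}. ?f x" by blast
  from bchoice[OF this] obtain \<phi> where \<phi>': "\<forall>x\<in>{1..n}.
      linear_map_on (scal M) (scal N) (space_at M x) (space_at N x) (\<phi> x) \<and>
      (\<forall>v\<in>space_at M x. (v, \<phi> x v) \<in> \<Phi> x)"
    by (elim exE)
  have "\<exists>g. linear_map_on (scal N) (scal M) (space_at N x) (space_at M x) g \<and>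
      (\<forall>w\<in>space_at N x. (g w, w) \<in> \<Phi> x)" (is "?g x") if "x \<in> {1..n}" for x
  proof -
    have x: "1 \<le> x" "x \<le> n" using that by auto
    have "partial_iso (scal N) (scal M) ((\<Phi> x)\<inverse>)"
      using iso(1)[OF x] by (simp add: partial_iso_converse)
    from c.partial_iso_function[OF this] show ?thesis
      unfolding Domain_converse Range_converse iso(2,3)[OF x] converse_iff .
  qed
  then have "\<forall>x\<in>{1..n}. ?g x" by blast
  from bchoice[OF this] obtain \<psi> where \<psi>': "\<forall>x\<in>{1..n}.
      linear_map_on (scal N) (scal M) (space_at N x) (space_at M x) (\<psi> x) \<and>
      (\<forall>w\<in>space_at N x. (\<psi> x w, w) \<in> \<Phi> x)"
    by (elim exE)
  have \<phi>: "(v, \<phi> x v) \<in> \<Phi> x" if "1 \<le> x" "x \<le> n" "v \<in> space_at M x" for x v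
    using \<phi>' that by simp
  have \<psi>: "(\<psi> x w, w) \<in> \<Phi> x" if "1 \<le> x" "x \<le> n" "w \<in> space_at N x" for x w
    using \<psi>' that by simp
  note unique = partial_iso_unique[OF iso(1)] and unique_left = partial_iso_unique_left[OF iso(1)]
  have "\<phi> y (map_at M y x v) = map_at N y x (\<phi> x v)" if r: "(x, y) \<in> r" and v: "v \<in> space_at M x" for x y v
  proof -
    note xy = M.mem_order[OF r]
    show ?thesis
      by (rule unique[OF xy(3,4) \<phi>[OF xy(3,4) M.map_mem[OF r v]] nat[OF r \<phi>[OF xy(1,2) v]]])
  qed
  moreover have "\<psi> y (map_at N y x w) = map_at M y x (\<psi> x w)" if r: "(x, y) \<in> r" and w: "w \<in> space_at N x" for x y w
  proof -
    note xy = M.mem_order[OF r]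
    show ?thesis
      by (rule unique_left[OF xy(3,4) \<psi>[OF xy(3,4) N.map_mem[OF r w]] nat[OF r \<psi>[OF xy(1,2) w]]])
  qed
  moreover have "\<psi> x (\<phi> x v) = v" if x: "1 \<le> x" "x \<le> n" and v: "v \<in> space_at M x" for x v
    by (rule unique_left[OF x \<psi>[OF x mem(2)[OF x \<phi>[OF x v]]] \<phi>[OF x v]])
  moreover have "\<phi> x (\<psi> x w) = w" if x: "1 \<le> x" "x \<le> n" and w: "w \<in> space_at N x" for x w
    by (rule unique[OF x \<phi>[OF x mem(1)[OF x \<psi>[OF x w]]] \<psi>[OF x w]])
  moreover have "\<forall>x\<in>{1..n}. linear_map_on (scal M) (scal N) (space_at M x) (space_at N x) (\<phi> x)"
    "\<forall>x\<in>{1..n}. linear_map_on (scal N) (scal M) (space_at N x) (space_at M x) (\<psi> x)"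
    using \<phi>' \<psi>' by blast+
  ultimately have inverse: "pmodule_morphism {1..n} r M N \<phi>" "pmodule_morphism {1..n} r N M \<psi>"
    "\<forall>x\<in>{1..n}. (\<forall>v\<in>space_at M x. \<psi> x (\<phi> x v) = v) \<and> (\<forall>w\<in>space_at N x. \<phi> x (\<psi> x w) = w)"
    by (simp_all add: pmodule_morphism_def)
  show ?thesis
    unfolding pmodule_isomorphic_def
    by (rule exI[of _ \<phi>], rule exI[of _ \<psi>]) (intro conjI inverse)
qed

end

end

section \<open>Kernels and ranks\<close>

text \<open>The \<open>y\<close>-component of \<open>T_op\<close> on a family of vectors. Arbitrary
  sets stand in for sources and sinks here and in \<open>path_kernel\<close>, since single vertices
  are removed from them later.\<close>

definition path_sum :: "(nat, 'k, 'v::ab_group_add) pmodule \<Rightarrow> nat rel \<Rightarrow> nat set \<Rightarrow> nat \<Rightarrow> (nat \<Rightarrow> 'v) \<Rightarrow> 'v" where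
  "path_sum M r A y u = (\<Sum>x\<in>A. if (x, y) \<in> r \<and> x \<noteq> y then map_at M y x (u x) else 0)"

definition path_kernel :: "(nat, 'k, 'v::ab_group_add) pmodule \<Rightarrow> nat rel \<Rightarrow> nat set \<Rightarrow> nat set \<Rightarrow> (nat \<Rightarrow> 'v) set" where
  "path_kernel M r A B = {u \<in> direct_sum A (space_at M). \<forall>y\<in>B. path_sum M r A y u = 0}"

lemma path_sum_insert:
  "finite A \<Longrightarrow> a \<notin> A \<Longrightarrow> path_sum M r (insert a A) y u =
    (if (a, y) \<in> r \<and> a \<noteq> y then map_at M y a (u a) else 0) + path_sum M r A y u"
  by (simp add: path_sum_def)

lemma path_sum_cong:
  "(\<And>x. x \<in> A \<Longrightarrow> u x = w x) \<Longrightarrow> path_sum M r A y u = path_sum M r A y w"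
  unfolding path_sum_def by (intro sum.cong) auto

context zigzag_module
begin

lemma vector_space_sum: "vector_space (fun_scale (scal M))"
  by (rule vector_space_fun_scale) (rule vector_space)

lemma linear_path_sum:
  assumes A: "A \<subseteq> {1..n}" and y: "1 \<le> y" "y \<le> n"
  shows "linear_map_on (fun_scale (scal M)) (scal M) (direct_sum A (space_at M)) (space_at M y) (path_sum M r A y)"
proof -
  interpret vector_space "scal M" by (rule vector_space)
  have "path_sum M r A y u \<in> space_at M y" if "u \<in> direct_sum A (space_at M)" for u
    unfolding path_sum_def using direct_sumD(1)[OF that] y
    by (intro subspace_sum subspace_space) (auto intro: zero_mem map_mem)
  moreover have "path_sum M r A y (u + w) = path_sum M r A y u + path_sum M r A y w"
    if "u \<in> direct_sum A (space_at M)" "w \<in> direct_sum A (space_at M)" for u w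
    unfolding path_sum_def sum.distrib[symmetric]
    using direct_sumD(1)[OF that(1)] direct_sumD(1)[OF that(2)]
    by (intro sum.cong) (auto simp: linear_map_on_add[OF linear_map])
  moreover have "path_sum M r A y (fun_scale (scal M) c u) = scal M c (path_sum M r A y u)"
    if "u \<in> direct_sum A (space_at M)" for u c
    unfolding path_sum_def scale_sum_right
    using direct_sumD(1)[OF that]
    by (intro sum.cong) (auto simp: fun_scale_apply linear_map_on_scale[OF linear_map])
  ultimately show ?thesis
    unfolding linear_map_on_def by blast
qed

lemma fd_sum: "A \<subseteq> {1..n} \<Longrightarrow> fd_subspace (fun_scale (scal M)) (direct_sum A (space_at M))"
  by (rule vector_space.fd_direct_sum[OF vector_space]) (use fd_space in \<open>auto intro: finite_subset\<close>)

lemma path_kernel_empty: "path_kernel M r A {} = direct_sum A (space_at M)"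
  by (simp add: path_kernel_def)

lemma fd_path_kernel:
  assumes A: "A \<subseteq> {1..n}" and B: "B \<subseteq> {1..n}"
  shows "fd_subspace (fun_scale (scal M)) (path_kernel M r A B)"
proof -
  interpret f: vector_space "fun_scale (scal M)" by (rule vector_space_sum)
  interpret p: vector_space_pair "fun_scale (scal M)" "scal M"
    by (simp add: vector_space_pair_def vector_space_sum vector_space)
  let ?D = "direct_sum A (space_at M)"
  have D: "fd_subspace (fun_scale (scal M)) ?D"
    using fd_sum[OF A] .
  have "f.subspace {u \<in> ?D. path_sum M r A y u = 0}" if "y \<in> B" for y
    using B that by (intro p.subspace_kernel_on[OF linear_path_sum[OF A]] f.fd_subspaceD[OF D]) auto
  then have "f.subspace (?D \<inter> (\<Inter>y\<in>B. {u \<in> ?D. path_sum M r A y u = 0}))"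
    by (intro f.subspace_inter f.subspace_Inter f.fd_subspaceD[OF D]) auto
  moreover have "?D \<inter> (\<Inter>y\<in>B. {u \<in> ?D. path_sum M r A y u = 0}) = path_kernel M r A B"
    by (auto simp: path_kernel_def)
  ultimately show ?thesis
    using f.fd_subspace_mono[OF D, of "path_kernel M r A B"] by (auto simp: path_kernel_def)
qed

text \<open>A vertex of \<open>A\<close> below \<open>j + 1\<close> is \<open>j\<close> or lies
  below \<open>j\<close>, and the latter is excluded; a single summand survives.\<close>

lemma path_sum_Suc_source:
  assumes A: "finite A" "A \<subseteq> {..j}" "j \<in> A" and anti: "\<And>x. x \<in> A \<Longrightarrow> (x, j) \<in> r \<Longrightarrow> x = j"
    and up: "(j, Suc j) \<in> r"
  shows "path_sum M r A (Suc j) u = map_at M (Suc j) j (u j)"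
proof -
  have "path_sum M r A (Suc j) u = (\<Sum>x\<in>A. if x = j then map_at M (Suc j) x (u x) else 0)"
    unfolding path_sum_def using A(2) anti order_to_Suc[OF up] up by (intro sum.cong) auto
  then show ?thesis using A by simp
qed

text \<open>Every path from \<open>A\<close> to \<open>j + 1\<close> passes through
  \<open>j\<close>, so all maps involved factor through \<open>space_at M j\<close>.\<close>

lemma path_sum_Suc_sink:
  assumes A: "A \<subseteq> {1..j}" "j \<notin> A" and up: "(j, Suc j) \<in> r"
    and u: "u \<in> direct_sum A (space_at M)"
  shows "path_sum M r A (Suc j) u = map_at M (Suc j) j (path_sum M r A j u)"
proof -
  have j: "1 \<le> j" "j \<le> n" using mem_order[OF up] by auto
  have u': "u x \<in> space_at M x" if "x \<in> A" for x using direct_sumD(1)[OF u that] .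
  have eq: "(if (x, Suc j) \<in> r \<and> x \<noteq> Suc j then map_at M (Suc j) x (u x) else 0) =
      map_at M (Suc j) j (if (x, j) \<in> r \<and> x \<noteq> j then map_at M j x (u x) else 0)" if "x \<in> A" for x
  proof -
    have "x \<le> j" "x \<noteq> j" using that A by auto
    then show ?thesis
      using order_to_Suc[OF up, of x] map_comp[OF _ up u'[OF that]] map_0[OF up] by auto
  qed
  show ?thesis
    unfolding path_sum_def
    by (subst linear_map_on_sum[OF linear_map[OF up] subspace_space[OF j] vector_space])
      (use eq u' j in \<open>auto intro: map_mem zero_mem\<close>)
qed

text \<open>Every path from \<open>j + 1\<close> to \<open>y\<close> passes through
  \<open>j\<close>, so the vector \<open>v\<close> at \<open>j + 1\<close> acts at \<open>y\<close>
  as its image at \<open>j\<close> does.\<close>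

lemma path_sum_replace_source:
  assumes A: "finite A" "A \<subseteq> {..j}" "j \<in> A" and y: "y < j" and down: "(Suc j, j) \<in> r"
    and v: "v \<in> space_at M (Suc j)" "w j = map_at M j (Suc j) v"
    and u: "u (Suc j) = v" "\<And>x. x \<in> A \<Longrightarrow> x \<noteq> j \<Longrightarrow> u x = w x"
  shows "path_sum M r (insert (Suc j) (A - {j})) y u = path_sum M r A y w"
proof -
  have "path_sum M r A y w =
      (if (j, y) \<in> r \<and> j \<noteq> y then map_at M y j (w j) else 0) + path_sum M r (A - {j}) y w"
    using path_sum_insert[of "A - {j}" j M r y w] A(1,3) by (simp add: insert_absorb)
  moreover have "path_sum M r (A - {j}) y u = path_sum M r (A - {j}) y w"
    using u(2) by (intro path_sum_cong) auto
  moreover have "Suc j \<notin> A - {j}" using A(2) by auto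
  ultimately show ?thesis
    using A(1) y v u(1) order_from_Suc[OF down, of y] map_comp[OF down _ v(1), of y]
    by (simp add: path_sum_insert)
qed

lemma path_kernel_neg:
  assumes A: "A \<subseteq> {1..n}" and B: "B \<subseteq> {1..n}" and u: "u \<in> path_kernel M r A B"
    and y: "1 \<le> y" "y \<le> n"
  shows "- u \<in> path_kernel M r A B" "path_sum M r A y (- u) = - path_sum M r A y u"
proof -
  interpret m: vector_space "scal M" by (rule vector_space)
  interpret f: vector_space "fun_scale (scal M)" by (rule vector_space_sum)
  have neg: "fun_scale (scal M) (- 1) u = - u"
    by (auto simp: fun_scale_def fun_eq_iff)
  have "f.subspace (path_kernel M r A B)"
    using fd_path_kernel[OF A B] f.fd_subspaceD by blast
  from f.subspace_scale[OF this u, of "- 1"] show "- u \<in> path_kernel M r A B"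
    by (simp only: neg)
  have "u \<in> direct_sum A (space_at M)" using u by (simp add: path_kernel_def)
  from linear_map_on_scale[OF linear_path_sum[OF A y] this, of "- 1"]
  show "path_sum M r A y (- u) = - path_sum M r A y u"
    by (simp add: neg)
qed

text \<open>The start value fits the one-point convention: a source contributes its whole space, a
  sink without sources an empty sum. A forward arrow makes \<open>j + 1\<close> a sink, whose sum is
  the image of what was recorded at \<open>j\<close>; its own equation is left out. A backward arrow
  makes \<open>j + 1\<close> a source, whose vectors are those with image at \<open>j\<close> in
  what was recorded there.\<close>

lemma transport_eq_path_kernel:
  fixes i j
  defines "A \<equiv> sources i j" and "B \<equiv> sinks i j"
  assumes "1 \<le> i" "i \<le> j" "j \<le> n"
  shows "(j \<in> A \<longrightarrow> transport M r i ((i, Suc i) \<in> r) j = (\<lambda>u. u j) ` path_kernel M r A B) \<and>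
    (j \<in> B \<longrightarrow> transport M r i ((i, Suc i) \<in> r) j = path_sum M r A j ` path_kernel M r A (B - {j}))"
  using assms(4,3,5) unfolding A_def B_def
proof (induction j rule: dec_induct)
  case base
  have "(\<lambda>u. u i) ` direct_sum {i} (space_at M) = space_at M i"
    by (auto simp: direct_sum_def image_iff intro!: exI[of _ "0(i := _)"])
  moreover have "direct_sum {} (space_at M) = {0}"
    by (auto simp: direct_sum_def fun_eq_iff)
  ultimately show ?case
    by (auto simp: transport_start sources_def sinks_def path_kernel_def path_sum_def)
next
  case (step j)
  define b where "b = ((i, Suc i) \<in> r)"
  define A where "A = sources i j"
  define B where "B = sinks i j"
  define T where "T k = transport M r i b k" for k
  have ij: "i \<le> j" "1 \<le> i" "j < n" "1 \<le> j" "j \<le> n"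
    using step by auto
  have AB: "A \<subseteq> {i..j}" "B \<subseteq> {i..j}" "j \<in> A \<longleftrightarrow> j \<notin> B"
    using sources_sinks_subset[of i j] source_or_sink[of i j] ij by (auto simp: A_def B_def)
  then have A: "A \<subseteq> {1..n}" "B \<subseteq> {1..n}" "A \<subseteq> {1..j}" "A \<subseteq> {..j}" "Suc j \<notin> A" "Suc j \<notin> B" "finite A"
    using ij by (auto intro: finite_subset)
  have IH: "j \<in> A \<Longrightarrow> T j = (\<lambda>u. u j) ` path_kernel M r A B"
      "j \<in> B \<Longrightarrow> T j = path_sum M r A j ` path_kernel M r A (B - {j})"
    using step.IH[OF ij(2,5)] by (auto simp: T_def b_def A_def B_def)
  show ?case
  proof (cases "(j, Suc j) \<in> r")
    case up: True
    note new = sources_sinks_Suc_up[OF ij(1) up, folded A_def B_def]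
    have "T (Suc j) = path_sum M r A (Suc j) ` path_kernel M r A (B - {j})"
    proof (cases "j \<in> A")
      case True
      have "path_sum M r A (Suc j) u = map_at M (Suc j) j (u j)" for u
        by (rule path_sum_Suc_source[OF A(7,4) True _ up]) (use True below_source in \<open>auto simp: A_def\<close>)
      moreover have "B - {j} = B" using AB(3) True by auto
      ultimately show ?thesis
        using IH(1)[OF True] ij(1) up by (simp add: T_def transport_up image_image)
    next
      case False
      have "path_sum M r A (Suc j) u = map_at M (Suc j) j (path_sum M r A j u)"
        if "u \<in> path_kernel M r A (B - {j})" for u
        using that by (intro path_sum_Suc_sink[OF A(3) False up]) (simp add: path_kernel_def)
      then show ?thesis
        using IH(2) False AB(3) ij(1) up by (simp add: T_def transport_up image_image)
    qed
    moreover have "insert (Suc j) (B - {j}) - {Suc j} = B - {j}" using A(6) by auto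
    ultimately show ?thesis
      unfolding new using A(5) by (simp add: T_def b_def)
  next
    case False
    then have down: "(Suc j, j) \<in> r" using up_or_down[of j] ij by auto
    note new = sources_sinks_Suc_down[OF ij(1) down, folded A_def B_def]
    define A' where "A' = insert (Suc j) (A - {j})"
    have Tj: "T (Suc j) = {v \<in> space_at M (Suc j). map_at M j (Suc j) v \<in> T j}"
      using ij(1) False by (simp add: T_def transport_down)
    have "T (Suc j) = (\<lambda>u. u (Suc j)) ` path_kernel M r A' B"
    proof (cases "j \<in> A")
      case True
      then have jB: "j \<notin> B" using AB(3) by simp
      have B: "y < j" if "y \<in> B" for y
        using that AB(2) jB by (metis atLeastAtMost_iff le_neq_implies_less subsetD)
      note replace = path_sum_replace_source[OF A(7,4) True B down]
      show ?thesis
      proof (intro set_eqI iffI)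
        fix v assume "v \<in> T (Suc j)"
        then obtain w where v: "v \<in> space_at M (Suc j)" and w: "w \<in> path_kernel M r A B"
          "map_at M j (Suc j) v = w j"
          using IH(1)[OF True] by (auto simp: Tj)
        \<comment> \<open>The source \<open>j\<close> gives way to \<open>j + 1\<close>, with a
          vector whose image at \<open>j\<close> is the old coordinate \<open>w j\<close>.\<close>
        define u where "u = w(j := 0, Suc j := v)"
        have "path_sum M r A' y u = path_sum M r A y w" if "y \<in> B" for y
          unfolding A'_def using A(5) by (intro replace[OF that v]) (auto simp: w u_def)
        then have "u \<in> path_kernel M r A' B"
          using w(1) v by (auto simp: path_kernel_def direct_sum_def A'_def u_def)
        moreover have "u (Suc j) = v" by (simp add: u_def)
        ultimately show "v \<in> (\<lambda>u. u (Suc j)) ` path_kernel M r A' B" by blast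
      next
        fix v assume "v \<in> (\<lambda>u. u (Suc j)) ` path_kernel M r A' B"
        then obtain u where u: "u \<in> path_kernel M r A' B" "u (Suc j) = v" by blast
        then have v: "v \<in> space_at M (Suc j)"
          by (auto simp: path_kernel_def direct_sum_def A'_def)
        define w where "w = u(Suc j := 0, j := map_at M j (Suc j) v)"
        have "path_sum M r A' y u = path_sum M r A y w" if "y \<in> B" for y
          unfolding A'_def using A(5) by (intro replace[OF that v]) (auto simp: u w_def)
        then have "w \<in> path_kernel M r A B"
          using u(1) v True A(5) map_mem[OF down v]
          by (auto simp: path_kernel_def direct_sum_def A'_def w_def)
        moreover have "w j = map_at M j (Suc j) v" by (simp add: w_def)
        ultimately show "v \<in> T (Suc j)"
          unfolding Tj IH(1)[OF True] using v by (auto simp: image_iff intro!: bexI[of _ w])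
      qed
    next
      case jA: False
      then have jB: "j \<in> B" and A': "A' = insert (Suc j) A" using AB(3) by (auto simp: A'_def)
      have BB: "B - {j} \<subseteq> {1..n}" using A(2) by auto
      \<comment> \<open>An old vertex above \<open>j + 1\<close> is \<open>j\<close> or lies above
        \<open>j\<close>, and distinct sinks are incomparable; so the new source enters only the
        equation at \<open>j\<close>.\<close>
      have "(Suc j, y) \<notin> r" if "y \<in> B" "y \<noteq> j" for y
        using that above_sink[of j i j y] jB AB(2) order_from_Suc[OF down, of y] by (auto simp: B_def)
      then have other: "path_sum M r A' y u = path_sum M r A y u" if "y \<in> B" "y \<noteq> j" for y u
        using that A(5,7) by (simp add: A' path_sum_insert)
      have atj: "path_sum M r A' j u = map_at M j (Suc j) (u (Suc j)) + path_sum M r A j u" for u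
        using A(5,7) down by (simp add: A' path_sum_insert)
      have restrict: "path_sum M r A y (u(Suc j := v)) = path_sum M r A y u" for y u v
        using A(5) by (intro path_sum_cong) auto
      show ?thesis
      proof (intro set_eqI iffI)
        fix v assume "v \<in> T (Suc j)"
        then obtain w where v: "v \<in> space_at M (Suc j)" and w: "w \<in> path_kernel M r A (B - {j})"
          "map_at M j (Suc j) v = path_sum M r A j w"
          using IH(2)[OF jB] by (auto simp: Tj)
        note neg = path_kernel_neg[OF A(1) BB w(1) ij(4,5)]
        \<comment> \<open>The equation at the sink \<open>j\<close> says that the image of
          \<open>v\<close> plus the old sum is 0; hence the sign.\<close>
        define u where "u = (- w)(Suc j := v)"
        have "path_sum M r A' y u = 0" if "y \<in> B" for y
        proof (cases "y = j")
          case True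
          then show ?thesis
            using atj[of u] neg(2) w(2) by (simp add: u_def restrict)
        next
          case False
          then show ?thesis
            using other[OF that False, of u] neg(1) that by (simp add: u_def restrict path_kernel_def)
        qed
        then have "u \<in> path_kernel M r A' B"
          using neg(1) v by (auto simp: path_kernel_def direct_sum_def A' u_def)
        moreover have "u (Suc j) = v" by (simp add: u_def)
        ultimately show "v \<in> (\<lambda>u. u (Suc j)) ` path_kernel M r A' B" by blast
      next
        fix v assume "v \<in> (\<lambda>u. u (Suc j)) ` path_kernel M r A' B"
        then obtain u where u: "u \<in> path_kernel M r A' B" "u (Suc j) = v" by blast
        then have v: "v \<in> space_at M (Suc j)"
          by (auto simp: path_kernel_def direct_sum_def A')
        define w where "w = u(Suc j := 0)"
        have "path_sum M r A y w = 0" if "y \<in> B - {j}" for y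
          using that other[of y u] u(1) by (simp add: path_kernel_def w_def restrict)
        then have w: "w \<in> path_kernel M r A (B - {j})"
          using u(1) A(5) by (auto simp: path_kernel_def direct_sum_def A' w_def)
        note neg = path_kernel_neg[OF A(1) BB w ij(4,5)]
        have "map_at M j (Suc j) v + path_sum M r A j w = 0"
          using atj[of u] u jB by (simp add: path_kernel_def w_def restrict)
        then have "map_at M j (Suc j) v = path_sum M r A j (- w)"
          by (simp add: neg(2) eq_neg_iff_add_eq_0)
        then show "v \<in> T (Suc j)"
          unfolding Tj IH(2)[OF jB] using v neg(1) by auto
      qed
    qed
    then show ?thesis
      unfolding new using A(6) by (simp add: T_def b_def A'_def)
  qed
qed

section \<open>Dimension counts for kernels, ranks and transported subspaces\<close>

definition dim_path_kernel :: "nat set \<Rightarrow> nat set \<Rightarrow> nat" where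
  "dim_path_kernel A B = vector_space.dim (fun_scale (scal M)) (path_kernel M r A B)"

lemma dim_path_kernel_no_sinks:
  assumes "A \<subseteq> {1..n}"
  shows "dim_path_kernel A {} = (\<Sum>x\<in>A. vector_space.dim (scal M) (space_at M x))"
  unfolding dim_path_kernel_def path_kernel_empty
  by (rule vector_space.dim_direct_sum[OF vector_space])
    (use assms fd_space in \<open>auto intro: finite_subset\<close>)

lemma dim_path_kernel_no_sources:
  assumes "B \<subseteq> {1..n}"
  shows "dim_path_kernel {} B = 0"
proof -
  interpret f: vector_space "fun_scale (scal M)" by (rule vector_space_sum)
  have "dim_path_kernel {} B \<le> dim_path_kernel {} {}"
    unfolding dim_path_kernel_def path_kernel_empty
    using f.dim_fd_subspace(1)[OF fd_sum f.fd_subspaceD[OF fd_path_kernel[OF _ assms]]]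
    by (simp add: path_kernel_def)
  then show ?thesis
    by (simp add: dim_path_kernel_no_sinks)
qed

text \<open>Rank-nullity for the coordinate at \<open>j\<close>: the families that vanish there are
  the families over the other sources.\<close>

lemma dim_path_kernel_remove_source:
  assumes A: "A \<subseteq> {1..n}" and B: "B \<subseteq> {1..n}" and j: "j \<in> A"
  shows "dim_path_kernel A B =
    vector_space.dim (scal M) ((\<lambda>u. u j) ` path_kernel M r A B) + dim_path_kernel (A - {j}) B"
proof -
  interpret p: vector_space_pair "fun_scale (scal M)" "scal M"
    by (simp add: vector_space_pair_def vector_space_sum vector_space)
  have lin: "linear_map_on (fun_scale (scal M)) (scal M) (path_kernel M r A B) UNIV (\<lambda>u. u j)"
    by (auto simp: linear_map_on_def fun_scale_apply)
  have fin: "finite A" using A by (auto intro: finite_subset)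
  have sum: "path_sum M r A y u = path_sum M r (A - {j}) y u" if "u j = 0" for y u
    using path_sum_insert[of "A - {j}" j M r y u] fin j that map_0 by (auto simp: insert_absorb)
  have z: "0 \<in> space_at M j"
    using A j by (intro zero_mem) auto
  have "{u \<in> path_kernel M r A B. u j = 0} = path_kernel M r (A - {j}) B"
  proof (intro set_eqI iffI)
    fix u assume "u \<in> {u \<in> path_kernel M r A B. u j = 0}"
    then show "u \<in> path_kernel M r (A - {j}) B"
      using sum[of u] by (auto simp: path_kernel_def direct_sum_def)
  next
    fix u assume u: "u \<in> path_kernel M r (A - {j}) B"
    then have "u j = 0" by (simp add: path_kernel_def direct_sum_def)
    then show "u \<in> {u \<in> path_kernel M r A B. u j = 0}"
      using u sum[of u] z j by (auto simp: path_kernel_def direct_sum_def)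
  qed
  then show ?thesis
    using p.rank_nullity(2)[OF lin fd_path_kernel[OF A B]] by (simp add: dim_path_kernel_def)
qed

text \<open>Rank-nullity for the sum at \<open>j\<close>, on the families that satisfy the other
  equations.\<close>

lemma dim_path_kernel_remove_sink:
  assumes A: "A \<subseteq> {1..n}" and B: "B \<subseteq> {1..n}" and j: "j \<in> B"
  shows "dim_path_kernel A (B - {j}) =
    vector_space.dim (scal M) (path_sum M r A j ` path_kernel M r A (B - {j})) + dim_path_kernel A B"
proof -
  interpret p: vector_space_pair "fun_scale (scal M)" "scal M"
    by (simp add: vector_space_pair_def vector_space_sum vector_space)
  have j': "1 \<le> j" "j \<le> n" and B': "B - {j} \<subseteq> {1..n}" using B j by auto
  have "linear_map_on (fun_scale (scal M)) (scal M) (path_kernel M r A (B - {j})) UNIV (path_sum M r A j)"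
    using linear_map_on_subset[OF linear_path_sum[OF A j']] by (simp add: path_kernel_def)
  moreover have "{u \<in> path_kernel M r A (B - {j}). path_sum M r A j u = 0} = path_kernel M r A B"
    using j by (auto simp: path_kernel_def)
  ultimately show ?thesis
    using p.rank_nullity(2)[OF _ fd_path_kernel[OF A B']] by (simp add: dim_path_kernel_def)
qed

text \<open>\<open>T_op\<close> kills the second summand, so its image is that of \<open>g\<close>
  on the sources, and the kernel of \<open>g\<close> is \<open>path_kernel\<close>. An empty set of
  sinks imposes no equation, so the right side is the dimension of the whole direct sum. The
  additive form avoids truncated subtraction.\<close>

lemma rank_T_op:
  assumes A: "A \<subseteq> {1..n}" and B: "B \<subseteq> {1..n}"
  shows "rank_on (pair_scal (scal M)) (T_space M (A, B)) (T_op r M (A, B)) + dim_path_kernel A B =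
    dim_path_kernel A {}"
proof -
  interpret p: vector_space_pair "fun_scale (scal M)" "pair_scal (scal M)"
    by (simp add: vector_space_pair_def vector_space_sum vector_space vector_space_pair_scal)
  let ?D = "direct_sum A (space_at M)"
  define g where "g u = (\<lambda>x::nat. 0 :: 'v, \<lambda>y. if y \<in> B then path_sum M r A y u else 0)" for u
  have T: "T_op r M (A, B) uv = g (fst uv)" for uv
    by (auto simp: T_op_def g_def path_sum_def fun_eq_iff)
  have "0 \<in> direct_sum B (space_at M)"
    using B zero_mem by (auto simp: direct_sum_def)
  then have "fst ` T_space M (A, B) = ?D"
    by (auto simp: T_space_def image_iff intro!: bexI[of _ 0])
  then have im: "T_op r M (A, B) ` T_space M (A, B) = g ` ?D"
    unfolding T by (metis image_image)
  note lin = linear_path_sum[OF A]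
  have "linear_map_on (fun_scale (scal M)) (pair_scal (scal M)) ?D UNIV g"
  proof -
    interpret m: vector_space "scal M" by (rule vector_space)
    have "g (u + w) = g u + g w" if "u \<in> ?D" "w \<in> ?D" for u w
      using linear_map_on_add[OF lin that] B by (auto simp: g_def fun_eq_iff)
    moreover have "g (fun_scale (scal M) c u) = pair_scal (scal M) c (g u)" if "u \<in> ?D" for u c
      using linear_map_on_scale[OF lin that] B by (auto simp: g_def pair_scal_def fun_eq_iff)
    ultimately show ?thesis by (simp add: linear_map_on_def)
  qed
  moreover have "{u \<in> ?D. g u = 0} = path_kernel M r A B"
    by (auto simp: path_kernel_def g_def zero_prod_def fun_eq_iff)
  ultimately show ?thesis
    using p.rank_nullity(2)[OF _ fd_sum[OF A], of UNIV g]
    by (simp add: dim_path_kernel_def rank_on_def im path_kernel_empty)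
qed

text \<open>The preimage of the whole space along a + 1 -> a is the whole space, and the image of
  {0} along a -> a + 1 is {0}. So for one of the two start values the starting point may be moved to
  the right.\<close>

lemma transport_Suc_start:
  assumes a: "1 \<le> a" "Suc a \<le> k" "k \<le> n" and b: "b \<longleftrightarrow> (a, Suc a) \<notin> r"
  shows "transport M r a b k = transport M r (Suc a) b k"
  using a(2,1,3)
proof (induction k rule: dec_induct)
  case base
  then have "(Suc a, a) \<in> r" if b
    using that b up_or_down[of a] by auto
  then show ?case
    using b map_0[of a "Suc a"] map_mem[of "Suc a" a]
    by (cases b) (auto simp: transport_start transport_up transport_down)
next
  case (step k)
  then show ?case
    by (cases "(k, Suc k) \<in> r") (auto simp: transport_up transport_down)
qed

lemma R_invariant_diagonal:
  "1 \<le> x \<Longrightarrow> x \<le> n \<Longrightarrow> R_invariant n r M (x, x) = vector_space.dim (scal M) (space_at M x)"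
  by (simp add: R_invariant_def rank_on_def)

lemma R_invariant_rank:
  assumes "1 \<le> i" "i < j" "j \<le> n"
  shows "R_invariant n r M (i, j) + dim_path_kernel (sources i j) (sinks i j) =
    dim_path_kernel (sources i j) {}"
proof -
  have "S_pair r i j = (sources i j, sinks i j)"
    using assms by (simp add: S_pair_def sources_def sinks_def)
  moreover have "sources i j \<subseteq> {1..n}" "sinks i j \<subseteq> {1..n}"
    using sources_sinks_subset[of i j] assms by auto
  ultimately show ?thesis
    using rank_T_op[of "sources i j" "sinks i j"] assms by (simp add: R_invariant_def)
qed

end

lemma pmodule_isomorphic_sym: "pmodule_isomorphic P r M N \<Longrightarrow> pmodule_isomorphic P r N M"
  unfolding pmodule_isomorphic_def by blast

section \<open>Comparison of the invariants of two modules\<close>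

context zigzag_module_pair
begin

text \<open>Adding \<open>j + 1\<close> and deleting it again leaves the sets for {i..j}, with
  \<open>j\<close> removed from the side that the last arrow changes. If \<open>j\<close> was on
  that side, this is the pair of the induction hypothesis; otherwise nothing was removed and
  \<open>dim\<close> applies.\<close>

lemma dim_path_kernel_remove_last:
  assumes dim: "\<And>j. i \<le> j \<Longrightarrow> j \<le> n \<Longrightarrow>
      M.dim_path_kernel (M.sources i j) (M.sinks i j) = N.dim_path_kernel (M.sources i j) (M.sinks i j)"
    and "1 \<le> i" "i \<le> j" "j \<le> n"
  shows "M.dim_path_kernel (M.sources i j - {j}) (M.sinks i j - {j}) =
    N.dim_path_kernel (M.sources i j - {j}) (M.sinks i j - {j})"
  using assms(3,2,4)
proof (induction j rule: dec_induct)
  case base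
  have "M.sources i i - {i} = {}" "M.sinks i i - {i} = {}"
    by (auto simp: M.sources_def M.sinks_def)
  then show ?case
    by (simp only: M.dim_path_kernel_no_sources N.dim_path_kernel_no_sources empty_subsetI)
next
  case (step j)
  then have ij: "i \<le> j" "1 \<le> i" "j \<le> n" "1 \<le> j" "j < n" by auto
  define A where "A = M.sources i j"
  define B where "B = M.sinks i j"
  have "Suc j \<notin> A" "Suc j \<notin> B" and jAB: "j \<in> A \<longleftrightarrow> j \<notin> B"
    using M.sources_sinks_subset[OF ij(1)] M.source_or_sink[OF ij(2,1,3)] by (auto simp: A_def B_def)
  then have simps: "A - {Suc j} = A" "B - {Suc j} = B"
    "insert (Suc j) (A - {j}) - {Suc j} = A - {j}" "insert (Suc j) (B - {j}) - {Suc j} = B - {j}"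
    by auto
  note IH = step.IH[OF ij(2,3), folded A_def B_def] and dimj = dim[OF ij(1,3), folded A_def B_def]
  have eq: "j \<notin> A \<Longrightarrow> A - {j} = A" "j \<notin> B \<Longrightarrow> B - {j} = B" by auto
  show ?case
  proof (cases "(j, Suc j) \<in> r")
    case True
    show ?thesis
      unfolding M.sources_sinks_Suc_up[OF ij(1) True] A_def[symmetric] B_def[symmetric] simps
      using IH dimj eq jAB by (cases "j \<in> A") auto
  next
    case False
    then have down: "(Suc j, j) \<in> r"
      using M.up_or_down[of j] ij by auto
    show ?thesis
      unfolding M.sources_sinks_Suc_down[OF ij(1) down] A_def[symmetric] B_def[symmetric] simps
      using IH dimj eq jAB by (cases "j \<in> A") auto
  qed
qed

text \<open>For the start value of the one-point convention the transported subspace is the image in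
  a rank-nullity count, so its dimension is a difference of kernel dimensions with and without the
  vertex \<open>k\<close>. The other start value is moved to \<open>a + 1\<close>, whence the
  induction on \<open>k - a\<close>.\<close>

lemma dim_transport_eq:
  assumes dim: "\<And>i j. 1 \<le> i \<Longrightarrow> i \<le> j \<Longrightarrow> j \<le> n \<Longrightarrow>
      M.dim_path_kernel (M.sources i j) (M.sinks i j) = N.dim_path_kernel (M.sources i j) (M.sinks i j)"
    and space: "\<And>x. 1 \<le> x \<Longrightarrow> x \<le> n \<Longrightarrow>
      vector_space.dim (scal M) (space_at M x) = vector_space.dim (scal N) (space_at N x)"
    and "1 \<le> a" "a \<le> k" "k \<le> n"
  shows "vector_space.dim (scal M) (transport M r a b k) = vector_space.dim (scal N) (transport N r a b k)"
  using assms(3-)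
proof (induction "k - a" arbitrary: a)
  case 0
  interpret m: vector_space "scal M" by (rule M.vector_space)
  interpret n: vector_space "scal N" by (rule N.vector_space)
  have "m.dim {0} = 0" "n.dim {0} = 0"
    using m.dim_le_card[of "{0}" "{}"] n.dim_le_card[of "{0}" "{}"] by simp_all
  moreover have "a = k" using 0 by simp
  ultimately show ?case
    using space[of k] 0 by (simp add: transport_start)
next
  case (Suc d)
  have k: "1 \<le> k" "a < k" using Suc by auto
  show ?case
  proof (cases "b \<longleftrightarrow> (a, Suc a) \<in> r")
    case True
    define A where "A = M.sources a k"
    define B where "B = M.sinks a k"
    have AB: "A \<subseteq> {1..n}" "B \<subseteq> {1..n}" "k \<in> A \<longleftrightarrow> k \<notin> B"
      using M.sources_sinks_subset[of a k] M.source_or_sink[of a k] Suc.prems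
      by (auto simp: A_def B_def)
    note M = M.transport_eq_path_kernel[OF Suc.prems, folded A_def B_def True]
      and N = N.transport_eq_path_kernel[OF Suc.prems, folded A_def B_def True]
    have eq: "M.dim_path_kernel A B = N.dim_path_kernel A B"
      "M.dim_path_kernel (A - {k}) (B - {k}) = N.dim_path_kernel (A - {k}) (B - {k})"
      using dim Suc.prems dim_path_kernel_remove_last[of a k] by (auto simp: A_def B_def)
    show ?thesis
    proof (cases "k \<in> A")
      case True
      moreover have "B - {k} = B" using True AB(3) by auto
      ultimately show ?thesis
        using M N eq M.dim_path_kernel_remove_source[OF AB(1,2) True]
          N.dim_path_kernel_remove_source[OF AB(1,2) True] by simp
    next
      case False
      then have kB: "k \<in> B" and "A - {k} = A" using AB(3) by auto
      then show ?thesis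
        using M N eq M.dim_path_kernel_remove_sink[OF AB(1,2) kB]
          N.dim_path_kernel_remove_sink[OF AB(1,2) kB] by simp
    qed
  next
    case False
    then have b: "b \<longleftrightarrow> (a, Suc a) \<notin> r" by auto
    have "1 \<le> a" "Suc a \<le> k" "k \<le> n" "d = k - Suc a" "1 \<le> Suc a"
      using Suc by auto
    then show ?thesis
      using Suc.hyps(1)[of "Suc a"] M.transport_Suc_start[OF _ _ _ b] N.transport_Suc_start[OF _ _ _ b]
      by simp
  qed
qed

text \<open>Applied coordinatewise, an isomorphism sends kernel to kernel by naturality, and does so
  injectively. An inequality suffices because the roles of the modules can be exchanged.\<close>

lemma dim_path_kernel_le:
  assumes iso: "pmodule_isomorphic {1..n} r M N" and A: "A \<subseteq> {1..n}" and B: "B \<subseteq> {1..n}"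
  shows "M.dim_path_kernel A B \<le> N.dim_path_kernel A B"
proof -
  obtain \<phi> \<psi> where \<phi>: "pmodule_morphism {1..n} r M N \<phi>"
    and \<psi>: "pmodule_morphism {1..n} r N M \<psi>"
    and inv: "\<And>x v. x \<in> {1..n} \<Longrightarrow> v \<in> space_at M x \<Longrightarrow> \<psi> x (\<phi> x v) = v"
    using iso unfolding pmodule_isomorphic_def by blast
  have lin: "linear_map_on (scal M) (scal N) (space_at M x) (space_at N x) (\<phi> x)" if "x \<in> A" for x
    using \<phi> A that by (auto simp: pmodule_morphism_def)
  have nat: "\<phi> y (map_at M y x v) = map_at N y x (\<phi> x v)" if "(x, y) \<in> r" "v \<in> space_at M x" for x y v
    using \<phi> that by (simp add: pmodule_morphism_def)
  interpret f: vector_space "fun_scale (scal N)" by (rule N.vector_space_sum)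
  interpret p: vector_space_pair "fun_scale (scal M)" "fun_scale (scal N)"
    by (simp add: vector_space_pair_def M.vector_space_sum N.vector_space_sum)
  define f where "f u = (\<lambda>x. if x \<in> A then \<phi> x (u x) else 0)" for u
  note KM = M.fd_path_kernel[OF A B] and KN = N.fd_path_kernel[OF A B]
  have u: "u x \<in> space_at M x" if "u \<in> path_kernel M r A B" "x \<in> A" for u x
    using that by (simp add: path_kernel_def direct_sum_def)
  have "f u \<in> path_kernel N r A B" if "u \<in> path_kernel M r A B" for u
  proof -
    have "path_sum N r A y (f u) = 0" if y: "y \<in> B" for y
    proof -
      have y': "1 \<le> y" "y \<le> n" using y B by auto
      then have lin_y: "linear_map_on (scal M) (scal N) (space_at M y) (space_at N y) (\<phi> y)"
        using \<phi> by (simp add: pmodule_morphism_def)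
      have zero: "\<phi> y 0 = 0"
        by (rule linear_map_on_0[OF lin_y]) (rule M.zero_mem[OF y'])
      have "path_sum N r A y (f u) =
          (\<Sum>x\<in>A. \<phi> y (if (x, y) \<in> r \<and> x \<noteq> y then map_at M y x (u x) else 0))"
        unfolding path_sum_def f_def
        using nat u[OF \<open>u \<in> path_kernel M r A B\<close>] zero by (intro sum.cong) auto
      also have "\<dots> = \<phi> y (path_sum M r A y u)"
        unfolding path_sum_def
        by (rule linear_map_on_sum[OF lin_y M.subspace_space[OF y'] M.vector_space, symmetric])
          (use u[OF \<open>u \<in> path_kernel M r A B\<close>] y' in \<open>auto intro: M.map_mem M.zero_mem\<close>)
      also have "\<dots> = 0"
        using \<open>u \<in> path_kernel M r A B\<close> y zero by (simp add: path_kernel_def)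
      finally show ?thesis .
    qed
    moreover have "f u \<in> direct_sum A (space_at N)"
      using linear_map_on_mem[OF lin] u[OF that] by (auto simp: direct_sum_def f_def)
    ultimately show ?thesis by (simp add: path_kernel_def)
  qed
  then have sub: "f ` path_kernel M r A B \<subseteq> path_kernel N r A B" by blast
  have "linear_map_on (fun_scale (scal M)) (fun_scale (scal N)) (path_kernel M r A B) UNIV f"
  proof -
    interpret n: vector_space "scal N" by (rule N.vector_space)
    show ?thesis
      using u unfolding linear_map_on_def
      by (auto simp: f_def fun_eq_iff fun_scale_apply linear_map_on_add[OF lin]
          linear_map_on_scale[OF lin])
  qed
  note f = this
  have "u = 0" if "u \<in> path_kernel M r A B" "f u = 0" for u
  proof
    fix x
    show "u x = 0 x"
    proof (cases "x \<in> A")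
      case True
      then have x: "x \<in> {1..n}" using A by auto
      then have "\<phi> x 0 = 0"
        using linear_map_on_0[OF lin[OF True]] M.zero_mem by simp
      moreover have "\<phi> x (u x) = 0"
        using True fun_cong[OF that(2), of x] by (simp add: f_def)
      ultimately show ?thesis
        using inv[OF x u[OF that(1) True]] inv[OF x, of 0] M.zero_mem x by simp
    next
      case False
      then show ?thesis
        using that(1) by (simp add: path_kernel_def direct_sum_def)
    qed
  qed
  then have "f.dim (f ` path_kernel M r A B) = M.dim_path_kernel A B"
    unfolding M.dim_path_kernel_def by (intro p.dim_image_inj_on[OF f KM])
  moreover have "f.subspace (f ` path_kernel M r A B)"
    using p.rank_nullity(1)[OF f KM] f.fd_subspaceD by blast
  ultimately show ?thesis
    unfolding N.dim_path_kernel_def using f.dim_fd_subspace(1)[OF KN _ sub] by simp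
qed

text \<open>Off the diagonal, ranks are differences of kernel dimensions; a single vertex without
  equations gives the diagonal. Outside the index range both sides are the default value of a
  restricted function.\<close>

lemma R_invariant_eqI:
  assumes dim: "\<And>A B. A \<subseteq> {1..n} \<Longrightarrow> B \<subseteq> {1..n} \<Longrightarrow> M.dim_path_kernel A B = N.dim_path_kernel A B"
  shows "R_invariant n r M = R_invariant n r N"
proof
  fix ij :: "nat \<times> nat"
  obtain i j where ij: "ij = (i, j)" by (cases ij)
  consider "1 \<le> i" "i = j" "j \<le> n" | "1 \<le> i" "i < j" "j \<le> n" | "\<not> (1 \<le> i \<and> i \<le> j \<and> j \<le> n)"
    by linarith
  then show "R_invariant n r M ij = R_invariant n r N ij"
  proof cases
    case 1
    then have "{i} \<subseteq> {1..n}" by auto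
    then show ?thesis
      using dim[of "{i}" "{}"] 1
      by (simp add: ij M.R_invariant_diagonal N.R_invariant_diagonal
          M.dim_path_kernel_no_sinks N.dim_path_kernel_no_sinks)
  next
    case 2
    have "M.sources i j \<subseteq> {1..n}" "M.sinks i j \<subseteq> {1..n}"
      using M.sources_sinks_subset[of i j] 2 by auto
    then show ?thesis
      using M.R_invariant_rank[OF 2] N.R_invariant_rank[OF 2] dim[of "M.sources i j"]
      by (simp add: ij)
  next
    case 3
    then show ?thesis by (auto simp: ij R_invariant_def)
  qed
qed

text \<open>The diagonal ranks give the dimensions of all direct sums, and the other ranks then
  those of the kernels for \<open>i < j\<close>. For \<open>i = j\<close> one of the two sets is
  empty, so the kernel is a full direct sum or zero.\<close>

lemma isomorphic_if_R_invariant_eq: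
  assumes R: "R_invariant n r M = R_invariant n r N"
  shows "pmodule_isomorphic {1..n} r M N"
proof -
  have space: "vector_space.dim (scal M) (space_at M x) = vector_space.dim (scal N) (space_at N x)"
    if "1 \<le> x" "x \<le> n" for x
    using R M.R_invariant_diagonal[OF that] N.R_invariant_diagonal[OF that] by simp
  have free: "M.dim_path_kernel A {} = N.dim_path_kernel A {}" if "A \<subseteq> {1..n}" for A
    using that space
    by (auto simp: M.dim_path_kernel_no_sinks N.dim_path_kernel_no_sinks intro!: sum.cong)
  have "M.dim_path_kernel (M.sources i j) (M.sinks i j) =
      N.dim_path_kernel (M.sources i j) (M.sinks i j)" if ij: "1 \<le> i" "i \<le> j" "j \<le> n" for i j
  proof -
    have AB: "M.sources i j \<subseteq> {1..n}" "M.sinks i j \<subseteq> {1..n}"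
      using M.sources_sinks_subset[of i j] ij by auto
    show ?thesis
    proof (cases "i < j")
      case True
      then show ?thesis
        using M.R_invariant_rank[OF ij(1) True ij(3)] N.R_invariant_rank[OF ij(1) True ij(3)]
          free[OF AB(1)] R by simp
    next
      case False
      then have "M.sources i j = {} \<or> M.sinks i j = {}"
        by (simp add: M.sources_def M.sinks_def)
      then show ?thesis
        using free[OF AB(1)] M.dim_path_kernel_no_sources[OF AB(2)]
          N.dim_path_kernel_no_sources[OF AB(2)] by auto
    qed
  qed
  then show ?thesis
    using isomorphic dim_transport_eq space by blast
qed

end

theorem theorem1:
  fixes n :: nat and r :: "nat rel"
    and M :: "(nat, 'k::field, 'v::ab_group_add) pmodule"
    and N :: "(nat, 'k, 'w::ab_group_add) pmodule"
  assumes "zigzag_poset n r"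
    and "persistence_module {1..n} r M" and "pointwise_finite_dimensional {1..n} M"
    and "persistence_module {1..n} r N" and "pointwise_finite_dimensional {1..n} N"
  shows "R_invariant n r M = R_invariant n r N \<longleftrightarrow> pmodule_isomorphic {1..n} r M N"
proof -
  interpret MN: zigzag_module_pair n r M N
    using assms by unfold_locales
  interpret NM: zigzag_module_pair n r N M
    using assms by unfold_locales
  show ?thesis
  proof
    show "pmodule_isomorphic {1..n} r M N" if "R_invariant n r M = R_invariant n r N"
      using that by (rule MN.isomorphic_if_R_invariant_eq)
    assume iso: "pmodule_isomorphic {1..n} r M N"
    show "R_invariant n r M = R_invariant n r N"
      using MN.dim_path_kernel_le[OF iso] NM.dim_path_kernel_le[OF pmodule_isomorphic_sym[OF iso]]
      by (intro MN.R_invariant_eqI) (meson order_antisym)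
  qed
qed

end
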